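(* Let $f\in\hat G$ correspond to a converging germ of holomorphic diffeomorphism of $(\mathbb{C}^n,0)$, with linear part $A=D_0f$. Let $G_0(f)\subset\hat G_0(f)$ be the set of converging linearizations of $f$. Then we have the following dichotomy: 1) Up to finite order, all formal linearizations in $\hat G_0(f)$ are converging. More precisely, for any $m\ge2$, $$\pi_m(\hat G_0(f))=\pi_m(G_0(f))\approx\mathbb{C}^{\delta(A,m)},$$ and the set $G_0(f)$ of converging linearizations is in one-to-one correspondence with the holomorphic centralizer of $A$. Moreover, there is a uniform radius of convergence $R_0>0$ such that for any $m\ge2$ and any $s_m\in\mathbb{C}^{\delta(A,m)}$ there exists a linearization $h$ of $f$ with $\pi_m(h)=s_m$ (under the identification $\pi_m(\hat G_0(f))\approx\mathbb{C}^{\delta(A,m)}$) and with radius of convergence at least $R_0$. 2) All formal linearizations in $\hat G_0(f)$ are diverging.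
   Context: $\hat G$ is the group, under composition, of formal diffeomorphisms of $(\mathbb{C}^n,0)$ fixing $0$ ($n$-tuples of formal power series without constant term and with invertible linear part); $\hat G_0\subset\hat G$ is the subgroup of elements $h$ with $D_0h=I$; $\pi_m$ is truncation to the $m$-jet. The linear part $A$ is assumed in Jordan normal form. $\hat G_0(f)=\{h\in\hat G_0:h\circ f\circ h^{-1}=A\}$ is the set of formal linearizations of $f$. An element of $\hat G_0$ is converging if its power series converge in a neighborhood of $0$, and diverging otherwise; having radius of convergence at least $R_0$ means convergence on the polydisc $\{|z_j|<R_0,\ 1\le j\le n\}$. $\mathrm{Cent}(A)=\{k\in\hat G_0:k\circ A=A\circ k\}$ is the formal centralizer of $A$, and the holomorphic centralizer of $A$ is its subset of converging elements. Identifying an $m$-jet in $\pi_m(\hat G_0)$ with the vector of its coefficients of order between $2$ and $m$, $\pi_m(\mathrm{Cent}(A))$ is a linear space, of dimension denoted $\delta(A,m)$. If $\hat G_0(f)\neq\emptyset$, then for a fixed $h_0\in\hat G_0(f)$ the map $k\mapsto k\circ h_0$ is a bijection $\mathrm{Cent}(A)\to\hat G_0(f)$ and induces affine isomorphisms $\mathbb{C}^{\delta(A,m)}\cong\pi_m(\mathrm{Cent}(A))\to\pi_m(\hat G_0(f))$; this is the identification used in the claim. *)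

theory Defs
  imports
    "HOL-Analysis.Analysis"
    "HOL-Algebra.Group"
    "Jordan_Normal_Form.Jordan_Normal_Form"
begin

no_notation Matrix.vec_index (infixl "$" 100)
hide_const (open) Matrix.mat Matrix.vec

section \<open>Formal power series in several variables\<close>

text \<open>Multi-indices have type \<open>nat ^ 'n\<close>; the variables are \<open>z $ j\<close> with \<open>j :: 'n\<close>.\<close>

typedef 'n mfps = "UNIV :: (nat ^ ('n::finite) \<Rightarrow> complex) set"
  morphisms mcoeff MFPS ..

lemma mcoeff_MFPS [simp]: "mcoeff (MFPS f) = f"
  by (simp add: MFPS_inverse)

lemma mfps_eqI: "(\<And>\<alpha>. mcoeff a \<alpha> = mcoeff b \<alpha>) \<Longrightarrow> a = b"
  by (metis ext mcoeff_inject)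

definition mdeg :: "nat ^ 'n \<Rightarrow> nat" where
  "mdeg \<alpha> = (\<Sum>j\<in>UNIV. \<alpha> $ j)"

definition splits :: "nat ^ 'n \<Rightarrow> ((nat ^ 'n) \<times> (nat ^ 'n)) set" where
  "splits \<gamma> = {(\<alpha>, \<beta>). \<alpha> + \<beta> = \<gamma>}"

lemma finite_mdeg_le: "finite {\<alpha> :: nat ^ 'n. mdeg \<alpha> \<le> d}"
proof -
  have "{\<alpha> :: nat ^ 'n. mdeg \<alpha> \<le> d} \<subseteq> vec_lambda ` (UNIV \<rightarrow>\<^sub>E {..d})"
  proof
    fix \<alpha> :: "nat ^ 'n"
    assume "\<alpha> \<in> {\<alpha>. mdeg \<alpha> \<le> d}"
    hence "mdeg \<alpha> \<le> d" by simp
    moreover have "\<alpha> $ j \<le> mdeg \<alpha>" for j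
      unfolding mdeg_def by (rule member_le_sum) auto
    ultimately have "vec_nth \<alpha> \<in> UNIV \<rightarrow>\<^sub>E {..d}"
      by (auto intro: order_trans)
    moreover have "\<alpha> = vec_lambda (vec_nth \<alpha>)" by simp
    ultimately show "\<alpha> \<in> vec_lambda ` (UNIV \<rightarrow>\<^sub>E {..d})" by blast
  qed
  thus ?thesis
    by (rule finite_subset) (simp add: finite_PiE)
qed

lemma mdeg_add: "mdeg (\<alpha> + \<beta>) = mdeg \<alpha> + mdeg \<beta>"
  by (simp add: mdeg_def sum.distrib)

lemma finite_splits [simp]: "finite (splits \<gamma>)"
proof (rule finite_subset)
  show "splits \<gamma> \<subseteq> {\<alpha>. mdeg \<alpha> \<le> mdeg \<gamma>} \<times> {\<alpha>. mdeg \<alpha> \<le> mdeg \<gamma>}"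
    by (auto simp: splits_def mdeg_add)
qed (simp add: finite_mdeg_le)

definition mfps_const :: "complex \<Rightarrow> 'n::finite mfps" where
  "mfps_const c = MFPS (\<lambda>\<alpha>. if \<alpha> = 0 then c else 0)"

definition mfps_var :: "'n::finite \<Rightarrow> 'n mfps" where
  "mfps_var j = MFPS (\<lambda>\<alpha>. if \<alpha> = axis j 1 then 1 else 0)"

instantiation mfps :: (finite) comm_ring_1
begin

definition "0 = mfps_const 0"
definition "1 = mfps_const 1"
definition "a + b = MFPS (\<lambda>\<alpha>. mcoeff a \<alpha> + mcoeff b \<alpha>)"
definition "a - b = MFPS (\<lambda>\<alpha>. mcoeff a \<alpha> - mcoeff b \<alpha>)"
definition "- a = MFPS (\<lambda>\<alpha>. - mcoeff a \<alpha>)"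
definition "a * b = MFPS (\<lambda>\<gamma>. \<Sum>(\<alpha>, \<beta>)\<in>splits \<gamma>. mcoeff a \<alpha> * mcoeff b \<beta>)"

instance
proof
  fix a b c :: "'a mfps"
  show "a * b * c = a * (b * c)"
  proof (rule mfps_eqI)
    fix \<gamma> :: "nat ^ 'a"
    let ?g = "\<lambda>(\<alpha>, \<beta>, \<delta>). mcoeff a \<alpha> * mcoeff b \<beta> * mcoeff c \<delta>"
    let ?T = "{(\<alpha>, \<beta>, \<delta>). \<alpha> + \<beta> + \<delta> = \<gamma>}"
    have "mcoeff (a * b * c) \<gamma> =
      (\<Sum>p\<in>splits \<gamma>. \<Sum>q\<in>splits (fst p). mcoeff a (fst q) * mcoeff b (snd q) * mcoeff c (snd p))"
      by (simp add: times_mfps_def sum_distrib_right split_def)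
    also have "\<dots> = (\<Sum>(p, q)\<in>(SIGMA p:splits \<gamma>. splits (fst p)).
        mcoeff a (fst q) * mcoeff b (snd q) * mcoeff c (snd p))"
      by (rule sum.Sigma) auto
    also have "\<dots> = sum ?g ?T"
      by (rule sum.reindex_bij_witness[of _ "\<lambda>(\<alpha>, \<beta>, \<delta>). ((\<alpha> + \<beta>, \<delta>), (\<alpha>, \<beta>))"
            "\<lambda>((\<mu>, \<delta>), (\<alpha>, \<beta>)). (\<alpha>, \<beta>, \<delta>)"]) (auto simp: splits_def)
    also have "\<dots> = (\<Sum>(p, q)\<in>(SIGMA p:splits \<gamma>. splits (snd p)).
        mcoeff a (fst p) * (mcoeff b (fst q) * mcoeff c (snd q)))"
      by (rule sum.reindex_bij_witness[of _ "\<lambda>((\<alpha>, \<mu>), (\<beta>, \<delta>)). (\<alpha>, \<beta>, \<delta>)"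
            "\<lambda>(\<alpha>, \<beta>, \<delta>). ((\<alpha>, \<beta> + \<delta>), (\<beta>, \<delta>))"]) (auto simp: splits_def add.assoc mult.assoc)
    also have "\<dots> = (\<Sum>p\<in>splits \<gamma>. \<Sum>q\<in>splits (snd p).
        mcoeff a (fst p) * (mcoeff b (fst q) * mcoeff c (snd q)))"
      by (rule sum.Sigma[symmetric]) auto
    also have "\<dots> = mcoeff (a * (b * c)) \<gamma>"
      by (simp add: times_mfps_def sum_distrib_left split_def)
    finally show "mcoeff (a * b * c) \<gamma> = mcoeff (a * (b * c)) \<gamma>" .
  qed
  show "a * b = b * a"
  proof (rule mfps_eqI)
    fix \<gamma> :: "nat ^ 'a"
    show "mcoeff (a * b) \<gamma> = mcoeff (b * a) \<gamma>"
      unfolding times_mfps_def mcoeff_MFPS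
      by (rule sum.reindex_bij_witness[of _ prod.swap prod.swap])
        (auto simp: splits_def add.commute mult.commute)
  qed
  show "1 * a = a"
  proof (rule mfps_eqI)
    fix \<gamma> :: "nat ^ 'a"
    have "mcoeff (1 * a) \<gamma> = (\<Sum>(\<alpha>, \<beta>)\<in>splits \<gamma>. (if \<alpha> = 0 then 1 else 0) * mcoeff a \<beta>)"
      by (simp add: times_mfps_def one_mfps_def mfps_const_def)
    also have "\<dots> = (\<Sum>(\<alpha>, \<beta>)\<in>{(0 :: nat ^ 'a, \<gamma>)}. (if \<alpha> = 0 then 1 else 0) * mcoeff a \<beta>)"
      by (rule sum.mono_neutral_right[OF finite_splits]) (auto simp: splits_def split: if_splits)
    finally show "mcoeff (1 * a) \<gamma> = mcoeff a \<gamma>" by simp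
  qed
  show "(a + b) * c = a * c + b * c"
    by (rule mfps_eqI)
      (simp add: times_mfps_def plus_mfps_def split_def distrib_right sum.distrib)
  show "(0 :: 'a mfps) \<noteq> 1"
  proof
    assume "(0 :: 'a mfps) = 1"
    hence "mcoeff (0 :: 'a mfps) 0 = mcoeff (1 :: 'a mfps) 0" by simp
    thus False by (simp add: zero_mfps_def one_mfps_def mfps_const_def)
  qed
qed (auto intro!: mfps_eqI
      simp: plus_mfps_def minus_mfps_def uminus_mfps_def zero_mfps_def mfps_const_def add_ac)

end

text \<open>Substitution \<open>a \<circ> H\<close> of a tuple \<open>H\<close> of series without constant term. Each monomial
  \<open>H\<^sup>\<alpha>\<close> then has order at least \<open>|\<alpha>|\<close>, so only \<open>|\<alpha>| \<le> |\<gamma>|\<close> contributes to the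
  coefficient of index \<open>\<gamma>\<close>, and the formal sum is finite.\<close>

definition mfps_subst :: "'n::finite mfps \<Rightarrow> 'n mfps ^ 'n \<Rightarrow> 'n mfps" where
  "mfps_subst a H = MFPS (\<lambda>\<gamma>. \<Sum>\<alpha> | mdeg \<alpha> \<le> mdeg \<gamma>.
      mcoeff a \<alpha> * mcoeff (\<Prod>j\<in>UNIV. (H $ j) ^ (\<alpha> $ j)) \<gamma>)"

definition fcomp_map :: "'n::finite mfps ^ 'n \<Rightarrow> 'n mfps ^ 'n \<Rightarrow> 'n mfps ^ 'n" (infixl "\<odot>" 70) where
  "F \<odot> H = (\<chi> i. mfps_subst (F $ i) H)"

definition linear_map :: "complex ^ 'n ^ 'n \<Rightarrow> 'n::finite mfps ^ 'n" where
  "linear_map A = (\<chi> i. \<Sum>j\<in>UNIV. mfps_const (A $ i $ j) * mfps_var j)"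

definition linear_part :: "'n::finite mfps ^ 'n \<Rightarrow> complex ^ 'n ^ 'n" where
  "linear_part F = (\<chi> i j. mcoeff (F $ i) (axis j 1))"

section \<open>Formal diffeomorphisms and linearizations\<close>

definition formal_diffeos :: "('n::finite mfps ^ 'n) set" where
  "formal_diffeos = {F. (\<forall>i. mcoeff (F $ i) 0 = 0) \<and> invertible (linear_part F)}"

definition Ghat :: "('n::finite mfps ^ 'n) monoid" where
  "Ghat = \<lparr>carrier = formal_diffeos, mult = (\<odot>), one = linear_map (mat 1)\<rparr>"

definition Ghat0 :: "('n::finite mfps ^ 'n) set" where
  "Ghat0 = {h \<in> carrier Ghat. linear_part h = mat 1}"

definition formal_linearizations :: "'n::finite mfps ^ 'n \<Rightarrow> ('n mfps ^ 'n) set" where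
  "formal_linearizations f =
     {h \<in> Ghat0. h \<otimes>\<^bsub>Ghat\<^esub> f \<otimes>\<^bsub>Ghat\<^esub> inv\<^bsub>Ghat\<^esub> h = linear_map (linear_part f)}"

definition formal_centralizer :: "complex ^ 'n ^ 'n \<Rightarrow> ('n::finite mfps ^ 'n) set" where
  "formal_centralizer A =
     {k \<in> Ghat0. k \<otimes>\<^bsub>Ghat\<^esub> linear_map A = linear_map A \<otimes>\<^bsub>Ghat\<^esub> k}"

section \<open>Convergence\<close>

definition converges_at :: "'n::finite mfps ^ 'n \<Rightarrow> complex ^ 'n \<Rightarrow> bool" where
  "converges_at F z \<longleftrightarrow>
     (\<forall>i. (\<lambda>\<alpha>. mcoeff (F $ i) \<alpha> * (\<Prod>j\<in>UNIV. (z $ j) ^ (\<alpha> $ j))) summable_on UNIV)"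

definition converging :: "'n::finite mfps ^ 'n \<Rightarrow> bool" where
  "converging F \<longleftrightarrow> (\<forall>\<^sub>F z in nhds 0. converges_at F z)"

definition radius_of_convergence_ge :: "'n::finite mfps ^ 'n \<Rightarrow> real \<Rightarrow> bool" where
  "radius_of_convergence_ge F R \<longleftrightarrow> (\<forall>z. (\<forall>j. norm (z $ j) < R) \<longrightarrow> converges_at F z)"

definition converging_linearizations :: "'n::finite mfps ^ 'n \<Rightarrow> ('n mfps ^ 'n) set" where
  "converging_linearizations f = {h \<in> formal_linearizations f. converging h}"

definition holomorphic_centralizer :: "complex ^ 'n ^ 'n \<Rightarrow> ('n::finite mfps ^ 'n) set" where
  "holomorphic_centralizer A = {k \<in> formal_centralizer A. converging k}"

section \<open>Jets\<close>

definition jet :: "nat \<Rightarrow> 'n::finite mfps ^ 'n \<Rightarrow> 'n mfps ^ 'n" where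
  "jet m F = (\<chi> i. MFPS (\<lambda>\<alpha>. if mdeg \<alpha> \<le> m then mcoeff (F $ i) \<alpha> else 0))"

text \<open>The coefficients of order between \<open>2\<close> and \<open>m\<close>, as a vector in the complex vector space of
  tuples of series. On \<open>Ghat0\<close> they carry the same information as the \<open>m\<close>-jet.\<close>

definition jet_vector :: "nat \<Rightarrow> 'n::finite mfps ^ 'n \<Rightarrow> 'n mfps ^ 'n" where
  "jet_vector m F =
     (\<chi> i. MFPS (\<lambda>\<alpha>. if 2 \<le> mdeg \<alpha> \<and> mdeg \<alpha> \<le> m then mcoeff (F $ i) \<alpha> else 0))"

definition cscale :: "complex \<Rightarrow> 'n::finite mfps ^ 'n \<Rightarrow> 'n mfps ^ 'n" where
  "cscale c F = (\<chi> i. MFPS (\<lambda>\<alpha>. c * mcoeff (F $ i) \<alpha>))"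

lemma vector_space_cscale: "vector_space (cscale :: complex \<Rightarrow> 'n::finite mfps ^ 'n \<Rightarrow> 'n mfps ^ 'n)"
  by unfold_locales
    (simp_all add: cscale_def Finite_Cartesian_Product.vec_eq_iff plus_mfps_def algebra_simps mcoeff_inverse)

definition centralizer_dim :: "complex ^ 'n ^ 'n \<Rightarrow> nat \<Rightarrow> nat" where
  "centralizer_dim A m = vector_space.dim cscale (jet_vector m ` formal_centralizer A)"

text \<open>\<open>\<complex>\<^sup>d\<close> for a number \<open>d\<close> that is not fixed by a type.\<close>

definition Cspace :: "nat \<Rightarrow> (nat \<Rightarrow> complex) set" where
  "Cspace d = {s. \<forall>i\<ge>d. s i = 0}"

definition linear_iso_on ::
  "(nat \<Rightarrow> complex) set \<Rightarrow> ('n::finite mfps ^ 'n) set \<Rightarrow> ((nat \<Rightarrow> complex) \<Rightarrow> 'n mfps ^ 'n) \<Rightarrow> bool" where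
  "linear_iso_on S T L \<longleftrightarrow> bij_betw L S T \<and>
     (\<forall>x\<in>S. \<forall>y\<in>S. L (\<lambda>i. x i + y i) = L x + L y) \<and>
     (\<forall>c. \<forall>x\<in>S. L (\<lambda>i. c * x i) = cscale c (L x))"

definition affine_iso_on ::
  "(nat \<Rightarrow> complex) set \<Rightarrow> ('n::finite mfps ^ 'n) set \<Rightarrow> ((nat \<Rightarrow> complex) \<Rightarrow> 'n mfps ^ 'n) \<Rightarrow> bool" where
  "affine_iso_on S T \<phi> \<longleftrightarrow> bij_betw \<phi> S T \<and>
     (\<forall>x\<in>S. \<forall>y\<in>S. \<forall>t. \<phi> (\<lambda>i. (1 - t) * x i + t * y i) = cscale (1 - t) (\<phi> x) + cscale t (\<phi> y))"

text \<open>\<open>\<phi>\<close> is the composite of a linear isomorphism from \<open>\<complex>\<^sup>\<delta>\<close> onto the \<open>m\<close>-jets of the formal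
  centralizer with the map induced on \<open>m\<close>-jets by \<open>k \<mapsto> k \<circ> h\<^sub>0\<close>; the latter sends the \<open>m\<close>-jet of any
  \<open>k\<close> in the centralizer to the \<open>m\<close>-jet of \<open>k \<circ> h\<^sub>0\<close>.\<close>

definition jet_identification ::
  "complex ^ 'n ^ 'n \<Rightarrow> 'n::finite mfps ^ 'n \<Rightarrow> nat \<Rightarrow> ((nat \<Rightarrow> complex) \<Rightarrow> 'n mfps ^ 'n) \<Rightarrow> bool" where
  "jet_identification A h0 m \<phi> \<longleftrightarrow>
     (\<exists>L. linear_iso_on (Cspace (centralizer_dim A m)) (jet_vector m ` formal_centralizer A) L \<and>
          (\<forall>s\<in>Cspace (centralizer_dim A m). \<forall>k\<in>formal_centralizer A.
              jet_vector m k = L s \<longrightarrow> \<phi> s = jet m (k \<otimes>\<^bsub>Ghat\<^esub> h0)))"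

section \<open>Jordan normal form\<close>

text \<open>The coordinates are numbered increasingly by the linear order on \<open>'n\<close>.\<close>

definition in_jordan_normal_form :: "complex ^ ('n::{finite, linorder}) ^ ('n::{finite, linorder}) \<Rightarrow> bool" where
  "in_jordan_normal_form A \<longleftrightarrow>
     (let e = (!) (sorted_list_of_set (UNIV :: 'n set)) in
      \<exists>n_as. Matrix.mat CARD('n) CARD('n) (\<lambda>(i, j). A $ e i $ e j) = jordan_matrix n_as)"

end

theory Submission
  imports Defs
begin

text \<open>The dichotomy holds because one converging linearization \<open>h0\<close> already yields converging
linearizations with every possible jet. All formal linearizations are \<open>k \<odot> h0\<close> with \<open>k\<close> in the
formal centralizer of \<open>A\<close> (\<open>centralizer_fcomp_linearization\<close>,
\<open>linearization_quotient_centralizer\<close>). Substitution of a linear map preserves the degree of a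
homogeneous polynomial, so \<open>k\<close> commutes with \<open>A\<close> if and only if each homogeneous component of \<open>k\<close>
does. Hence the truncation \<open>jet m k\<close> is again in the centralizer (\<open>jet_formal_centralizer\<close>), and
\<open>jet m k \<odot> h0\<close> is a linearization with the same \<open>m\<close>-jet as \<open>k \<odot> h0\<close>. Its outer factor is
polynomial, so it converges wherever \<open>h0\<close> converges absolutely; this gives a radius that depends
neither on \<open>m\<close> nor on the jet (\<open>jets_linearized_with_uniform_radius\<close>).

The remaining statements of the first alternative rest on three facts. Composition of tuples
without constant term is associative, and tuples tangent to the identity are invertible. The
map \<open>k \<mapsto> k \<odot> h0\<close> is affine in \<open>k\<close>, it acts on \<open>m\<close>-jets, and the centralizer is an affine space
through the identity; so every identification of its jets with \<open>\<complex>\<^sup>\<delta>\<close> gives an affine isomorphism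
onto the jets of linearizations (\<open>jet_identification_affine_iso\<close>). Finally, composites and
inverses of converging tuples converge, so \<open>k \<mapsto> k \<odot> h0\<close> matches converging elements on both sides
(\<open>holomorphic_centralizer_bij\<close>).

Convergence is controlled by the truncated norms \<open>\<Sum>\<^bsub>|\<alpha>| \<le> d\<^esub> |a\<^sub>\<alpha>| r\<^bsup>|\<alpha>|\<^esup>\<close>: a series converges
absolutely on the closed polydisc of radius \<open>r\<close> if and only if they stay bounded as \<open>d\<close> grows. They
are submultiplicative, and they involve only finite sums, so that the inverse of a converging
tuple can be bounded by induction on \<open>d\<close> (\<open>converging_inverse\<close>).\<close>

section \<open>Coefficients and monomials\<close>

(* The scalar multiplication of modules has the same infix symbol as composition. *)
no_notation Module.smult (infixl "\<odot>\<index>" 70)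

lemma mcoeff_add [simp]: "mcoeff (a + b) \<gamma> = mcoeff a \<gamma> + mcoeff b \<gamma>"
  by (simp add: plus_mfps_def)

lemma mcoeff_diff [simp]: "mcoeff (a - b) \<gamma> = mcoeff a \<gamma> - mcoeff b \<gamma>"
  by (simp add: minus_mfps_def)

lemma mcoeff_zero [simp]: "mcoeff 0 \<gamma> = 0"
  by (simp add: zero_mfps_def mfps_const_def)

lemma mcoeff_const: "mcoeff (mfps_const c) \<gamma> = (if \<gamma> = 0 then c else 0)"
  by (simp add: mfps_const_def)

lemma mcoeff_one: "mcoeff 1 \<gamma> = (if \<gamma> = 0 then 1 else 0)"
  by (simp add: one_mfps_def mcoeff_const)

lemma mcoeff_mult: "mcoeff (a * b) \<gamma> = (\<Sum>(\<alpha>, \<beta>)\<in>splits \<gamma>. mcoeff a \<alpha> * mcoeff b \<beta>)"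
  by (simp add: times_mfps_def)

lemma mcoeff_sum: "mcoeff (sum F S) \<gamma> = (\<Sum>x\<in>S. mcoeff (F x) \<gamma>)"
  by (induction S rule: infinite_finite_induct) simp_all

lemma mcoeff_const_mult [simp]:
  fixes a :: "'a::finite mfps"
  shows "mcoeff (mfps_const c * a) \<gamma> = c * mcoeff a \<gamma>"
proof -
  have "mcoeff (mfps_const c * a) \<gamma>
      = (\<Sum>(\<alpha>, \<beta>)\<in>splits \<gamma>. (if \<alpha> = 0 then c else 0) * mcoeff a \<beta>)"
    by (simp add: mcoeff_mult mcoeff_const)
  also have "\<dots> = (\<Sum>(\<alpha>, \<beta>)\<in>{(0 :: nat ^ 'a, \<gamma>)}. (if \<alpha> = 0 then c else 0) * mcoeff a \<beta>)"
    by (rule sum.mono_neutral_right[OF finite_splits]) (auto simp: splits_def split: if_splits)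
  finally show ?thesis by simp
qed

lemma mdeg_zero [simp]: "mdeg 0 = 0"
  by (simp add: mdeg_def)

lemma mdeg_eq_0_iff [simp]: "mdeg \<alpha> = 0 \<longleftrightarrow> \<alpha> = 0"
  by (auto simp: mdeg_def Finite_Cartesian_Product.vec_eq_iff)

lemma mdeg_axis [simp]: "mdeg (axis j n) = n"
  by (simp add: mdeg_def axis_def)

lemma mdeg_le_1: "{\<alpha> :: nat ^ 'n. mdeg \<alpha> \<le> 1} = insert 0 (range (\<lambda>j. axis j 1))"
proof (intro equalityI subsetI)
  fix \<alpha> :: "nat ^ 'n"
  assume "\<alpha> \<in> {\<alpha>. mdeg \<alpha> \<le> 1}"
  then have le: "mdeg \<alpha> \<le> 1" by simp
  show "\<alpha> \<in> insert 0 (range (\<lambda>j. axis j 1))"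
  proof (cases "\<alpha> = 0")
    case False
    then obtain j where j: "\<alpha> $ j \<noteq> 0"
      by (auto simp: Finite_Cartesian_Product.vec_eq_iff)
    have split: "mdeg \<alpha> = \<alpha> $ j + (\<Sum>i\<in>UNIV - {j}. \<alpha> $ i)"
      unfolding mdeg_def by (rule sum.remove) auto
    with le j have "\<alpha> $ j = 1" "(\<Sum>i\<in>UNIV - {j}. \<alpha> $ i) = 0" by linarith+
    then have "\<alpha> = axis j 1"
      by (auto simp: Finite_Cartesian_Product.vec_eq_iff axis_def)
    then show ?thesis by blast
  qed simp
qed auto

definition mpow :: "'n::finite mfps ^ 'n \<Rightarrow> nat ^ 'n \<Rightarrow> 'n mfps" where
  "mpow H \<alpha> = (\<Prod>j\<in>UNIV. (H $ j) ^ (\<alpha> $ j))"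

lemma mpow_zero [simp]: "mpow H 0 = 1"
  by (simp add: mpow_def)

lemma mpow_add: "mpow H (\<alpha> + \<beta>) = mpow H \<alpha> * mpow H \<beta>"
  by (simp add: mpow_def power_add prod.distrib)

lemma mpow_axis: "mpow H (axis j 1) = H $ j"
proof -
  have "mpow H (axis j 1) = (\<Prod>i\<in>UNIV. if i = j then H $ j else 1)"
    unfolding mpow_def axis_def by (intro prod.cong) auto
  then show ?thesis by simp
qed

text \<open>Orders, homogeneity, closeness of two tuples and norm bounds all pass from the components of a tuple
to its monomials in the same way: the relation is graded by the degree and compatible with products.
The relation is binary so that it can compare the monomials of two tuples.\<close>

lemma graded_mpow:
  assumes one: "R 0 1 1"
    and mult: "\<And>p q a b a' b'. R p a a' \<Longrightarrow> R q b b' \<Longrightarrow> R (p + q) (a * b) (a' * b')"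
    and base: "\<And>j. R 1 (H $ j) (K $ j)"
  shows "R (mdeg \<alpha>) (mpow H \<alpha>) (mpow K \<alpha>)"
proof -
  have power: "R n ((H $ j) ^ n) ((K $ j) ^ n)" for j n
    by (induction n) (use one mult[OF base] in auto)
  have "R (\<Sum>j\<in>S. \<alpha> $ j) (\<Prod>j\<in>S. (H $ j) ^ (\<alpha> $ j)) (\<Prod>j\<in>S. (K $ j) ^ (\<alpha> $ j))"
    if "finite S" for S
    using that by (induction S) (use one mult[OF power] in auto)
  from this[of UNIV] show ?thesis by (simp add: mdeg_def mpow_def)
qed

section \<open>Order and homogeneous components\<close>

definition ord_ge :: "nat \<Rightarrow> 'n::finite mfps \<Rightarrow> bool" where
  "ord_ge n a \<longleftrightarrow> (\<forall>\<gamma>. mdeg \<gamma> < n \<longrightarrow> mcoeff a \<gamma> = 0)"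

abbreviation no_const :: "'n::finite mfps ^ 'n \<Rightarrow> bool" where
  "no_const H \<equiv> (\<forall>j. ord_ge 1 (H $ j))"

lemma ord_ge_1_iff: "ord_ge 1 a \<longleftrightarrow> mcoeff a 0 = 0"
  by (auto simp: ord_ge_def)

lemma ord_ge_add: "ord_ge n a \<Longrightarrow> ord_ge n b \<Longrightarrow> ord_ge n (a + b)"
  and ord_ge_diff: "ord_ge n a \<Longrightarrow> ord_ge n b \<Longrightarrow> ord_ge n (a - b)"
  by (simp_all add: ord_ge_def)

lemma ord_ge_0 [simp]: "ord_ge 0 a"
  by (simp add: ord_ge_def)

lemma ord_ge_zero [simp]: "ord_ge n 0"
  by (simp add: ord_ge_def)

lemma ord_ge_mono: "ord_ge n a \<Longrightarrow> m \<le> n \<Longrightarrow> ord_ge m a"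
  by (simp add: ord_ge_def)

lemma ord_ge_mult:
  assumes "ord_ge m a" "ord_ge n b"
  shows "ord_ge (m + n) (a * b)"
  unfolding ord_ge_def mcoeff_mult
proof (intro allI impI sum.neutral ballI, clarify)
  fix \<gamma> \<alpha> \<beta> :: "nat ^ 'a"
  assume "mdeg \<gamma> < m + n" "(\<alpha>, \<beta>) \<in> splits \<gamma>"
  then have "mdeg \<alpha> < m \<or> mdeg \<beta> < n" by (auto simp: splits_def mdeg_add)
  then show "mcoeff a \<alpha> * mcoeff b \<beta> = 0"
    using assms by (auto simp: ord_ge_def)
qed

definition homogeneous :: "nat \<Rightarrow> 'n::finite mfps \<Rightarrow> bool" where
  "homogeneous n a \<longleftrightarrow> (\<forall>\<gamma>. mdeg \<gamma> \<noteq> n \<longrightarrow> mcoeff a \<gamma> = 0)"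

lemma homogeneous_mult:
  assumes "homogeneous m a" "homogeneous n b"
  shows "homogeneous (m + n) (a * b)"
  unfolding homogeneous_def mcoeff_mult
proof (intro allI impI sum.neutral ballI, clarify)
  fix \<gamma> \<alpha> \<beta> :: "nat ^ 'a"
  assume "mdeg \<gamma> \<noteq> m + n" "(\<alpha>, \<beta>) \<in> splits \<gamma>"
  then have "mdeg \<alpha> \<noteq> m \<or> mdeg \<beta> \<noteq> n" by (auto simp: splits_def mdeg_add)
  then show "mcoeff a \<alpha> * mcoeff b \<beta> = 0"
    using assms by (auto simp: homogeneous_def)
qed

lemma homogeneous_imp_ord_ge: "homogeneous n a \<Longrightarrow> ord_ge n a"
  by (simp add: homogeneous_def ord_ge_def)

lemma homogeneous_one: "homogeneous 0 1"
  by (simp add: homogeneous_def mcoeff_one)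

lemma homogeneous_mpow:
  assumes "\<And>j. homogeneous 1 (H $ j)"
  shows "homogeneous (mdeg \<alpha>) (mpow H \<alpha>)"
  by (rule graded_mpow[where R = "\<lambda>p a _. homogeneous p a"])
    (use assms in \<open>auto intro: homogeneous_mult homogeneous_one\<close>)

lemma ord_ge_mpow: "no_const H \<Longrightarrow> ord_ge (mdeg \<alpha>) (mpow H \<alpha>)"
  by (rule graded_mpow[where R = "\<lambda>p a _. ord_ge p a"])
    (auto intro: ord_ge_mult)

text \<open>If two tuples agree up to degree \<open>d\<close>, their monomials of degree \<open>|\<alpha>|\<close> agree up to degree
\<open>d + |\<alpha>| - 1\<close>, because in \<open>a b - a' b' = a (b - b') + (a - a') b'\<close> the factors \<open>a\<close> and \<open>b'\<close> contribute
their own order. The gain of a degree for \<open>|\<alpha>| \<ge> 2\<close> drives the construction of inverses and the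
estimate of their coefficients.\<close>

lemma mpow_close:
  assumes H: "no_const H" and K: "no_const K" and close: "\<And>j. ord_ge (Suc d) (H $ j - K $ j)"
  shows "ord_ge (d + mdeg \<alpha>) (mpow H \<alpha> - mpow K \<alpha>)"
proof -
  let ?R = "\<lambda>p a b. ord_ge p a \<and> ord_ge p b \<and> ord_ge (d + p) (a - b)"
  have "?R (mdeg \<alpha>) (mpow H \<alpha>) (mpow K \<alpha>)"
  proof (rule graded_mpow[where R = ?R])
    fix p q and a b a' b' :: "'a mfps"
    assume a: "?R p a a'" and b: "?R q b b'"
    have "ord_ge (p + (d + q)) (a * (b - b'))" "ord_ge ((d + p) + q) ((a - a') * b')"
      using a b by (blast intro: ord_ge_mult)+
    then have "ord_ge (d + (p + q)) (a * (b - b') + (a - a') * b')"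
      by (intro ord_ge_add) (simp_all add: ac_simps)
    also have "a * (b - b') + (a - a') * b' = a * b - a' * b'"
      by (simp add: algebra_simps)
    finally show "?R (p + q) (a * b) (a' * b')"
      using a b by (blast intro: ord_ge_mult)
  qed (use assms in auto)
  then show ?thesis by blast
qed

section \<open>Substitution\<close>

lemma mcoeff_subst:
  "mcoeff (mfps_subst a H) \<gamma> = (\<Sum>\<alpha> | mdeg \<alpha> \<le> mdeg \<gamma>. mcoeff a \<alpha> * mcoeff (mpow H \<alpha>) \<gamma>)"
  by (simp add: mfps_subst_def mpow_def)

text \<open>Since \<open>mpow H \<alpha>\<close> has order at least \<open>|\<alpha>|\<close>, the range of summation can be enlarged at will; one
common range for all coefficients of bounded degree makes sums over multi-indices exchangeable.\<close>

lemma mcoeff_subst_upto: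
  assumes "no_const H" "mdeg \<gamma> \<le> d"
  shows "mcoeff (mfps_subst a H) \<gamma> = (\<Sum>\<alpha> | mdeg \<alpha> \<le> d. mcoeff a \<alpha> * mcoeff (mpow H \<alpha>) \<gamma>)"
  unfolding mcoeff_subst
  by (rule sum.mono_neutral_left)
    (use assms ord_ge_mpow[OF assms(1)] in \<open>auto simp: finite_mdeg_le ord_ge_def\<close>)

lemma subst_add: "mfps_subst (a + b) H = mfps_subst a H + mfps_subst b H"
  by (rule mfps_eqI) (simp add: mcoeff_subst distrib_right sum.distrib)

lemma subst_diff: "mfps_subst (a - b) H = mfps_subst a H - mfps_subst b H"
  by (rule mfps_eqI) (simp add: mcoeff_subst left_diff_distrib sum_subtractf)

lemma subst_const_mult: "mfps_subst (mfps_const c * a) H = mfps_const c * mfps_subst a H"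
  by (rule mfps_eqI) (simp add: mcoeff_subst sum_distrib_left mult.assoc)

lemma subst_zero: "mfps_subst 0 H = 0"
  by (rule mfps_eqI) (simp add: mcoeff_subst)

lemma subst_sum: "mfps_subst (sum F S) H = (\<Sum>x\<in>S. mfps_subst (F x) H)"
  by (induction S rule: infinite_finite_induct) (simp_all add: subst_add subst_zero)

lemma subst_one: "mfps_subst 1 H = 1"
  by (rule mfps_eqI)
    (simp add: mcoeff_subst mcoeff_one finite_mdeg_le mult_delta_left)

text \<open>Both sides are sums of \<open>a\<^sub>\<alpha> b\<^sub>\<beta> H\<^bsup>\<alpha> + \<beta>\<^esup>\<close>. On the left the pairs are restricted by
\<open>|\<alpha> + \<beta>| \<le> |\<gamma>|\<close>, on the right each index separately, and the additional terms have too high an order.\<close>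

lemma subst_mult:
  assumes "no_const H"
  shows "mfps_subst (a * b) H = mfps_subst a H * mfps_subst b H"
proof (rule mfps_eqI)
  fix \<gamma> :: "nat ^ 'a"
  define D where "D = {\<alpha> :: nat ^ 'a. mdeg \<alpha> \<le> mdeg \<gamma>}"
  have fin: "finite D" by (simp add: D_def finite_mdeg_le)
  let ?t = "\<lambda>(\<alpha>, \<beta>). mcoeff a \<alpha> * mcoeff b \<beta> * mcoeff (mpow H (\<alpha> + \<beta>)) \<gamma>"
  have "mcoeff (mfps_subst (a * b) H) \<gamma> = (\<Sum>\<delta>\<in>D. \<Sum>(\<alpha>, \<beta>)\<in>splits \<delta>.
      mcoeff a \<alpha> * mcoeff b \<beta> * mcoeff (mpow H \<delta>) \<gamma>)"
    by (simp add: mcoeff_subst D_def mcoeff_mult sum_distrib_right split_def)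
  also have "\<dots> = (\<Sum>(\<delta>, \<alpha>, \<beta>)\<in>Sigma D splits.
      mcoeff a \<alpha> * mcoeff b \<beta> * mcoeff (mpow H \<delta>) \<gamma>)"
    using fin by (subst sum.Sigma) auto
  also have "\<dots> = sum ?t {(\<alpha>, \<beta>). \<alpha> + \<beta> \<in> D}"
    by (rule sum.reindex_bij_witness[of _ "\<lambda>(\<alpha>, \<beta>). (\<alpha> + \<beta>, \<alpha>, \<beta>)" snd])
      (auto simp: splits_def)
  also have "\<dots> = sum ?t (D \<times> D)"
  proof (rule sum.mono_neutral_left)
    have "mdeg \<delta> \<le> mdeg \<gamma>" if "mcoeff (mpow H \<delta>) \<gamma> \<noteq> 0" for \<delta>
      using ord_ge_mpow[OF assms, of \<delta>] that by (auto simp: ord_ge_def not_less[symmetric])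
    then show "\<forall>p\<in>D \<times> D - {(\<alpha>, \<beta>). \<alpha> + \<beta> \<in> D}. ?t p = 0"
      by (fastforce simp: D_def)
  qed (use fin in \<open>auto simp: D_def mdeg_add\<close>)
  also have "\<dots> = (\<Sum>\<alpha>\<in>D. \<Sum>\<beta>\<in>D. \<Sum>(\<mu>, \<nu>)\<in>splits \<gamma>.
      mcoeff a \<alpha> * mcoeff (mpow H \<alpha>) \<mu> * (mcoeff b \<beta> * mcoeff (mpow H \<beta>) \<nu>))"
    unfolding sum.cartesian_product[symmetric]
    by (simp add: mpow_add mcoeff_mult sum_distrib_left split_def ac_simps)
  also have "\<dots> = (\<Sum>(\<mu>, \<nu>)\<in>splits \<gamma>. \<Sum>\<alpha>\<in>D. \<Sum>\<beta>\<in>D.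
      mcoeff a \<alpha> * mcoeff (mpow H \<alpha>) \<mu> * (mcoeff b \<beta> * mcoeff (mpow H \<beta>) \<nu>))"
    unfolding split_def
    by (subst sum.swap[of _ D "splits \<gamma>"], subst sum.swap[of _ D "splits \<gamma>"]) (rule refl)
  also have "\<dots> = (\<Sum>(\<mu>, \<nu>)\<in>splits \<gamma>. mcoeff (mfps_subst a H) \<mu> * mcoeff (mfps_subst b H) \<nu>)"
  proof (rule sum.cong[OF refl], clarify)
    fix \<mu> \<nu> :: "nat ^ 'a"
    assume "(\<mu>, \<nu>) \<in> splits \<gamma>"
    then have "mdeg \<mu> \<le> mdeg \<gamma>" "mdeg \<nu> \<le> mdeg \<gamma>" by (auto simp: splits_def mdeg_add)
    then show "(\<Sum>\<alpha>\<in>D. \<Sum>\<beta>\<in>D.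
        mcoeff a \<alpha> * mcoeff (mpow H \<alpha>) \<mu> * (mcoeff b \<beta> * mcoeff (mpow H \<beta>) \<nu>)) =
        mcoeff (mfps_subst a H) \<mu> * mcoeff (mfps_subst b H) \<nu>"
      by (simp add: mcoeff_subst_upto[OF assms, of _ "mdeg \<gamma>"] D_def sum_product)
  qed
  finally show "mcoeff (mfps_subst (a * b) H) \<gamma> = mcoeff (mfps_subst a H * mfps_subst b H) \<gamma>"
    by (simp add: mcoeff_mult)
qed

lemma subst_mpow:
  assumes "no_const K"
  shows "mfps_subst (mpow H \<alpha>) K = mpow (H \<odot> K) \<alpha>"
proof -
  have pow: "mfps_subst (a ^ n) K = mfps_subst a K ^ n" for a n
    by (induction n) (simp_all add: subst_one subst_mult[OF assms])
  have "mfps_subst (\<Prod>j\<in>S. (H $ j) ^ (\<alpha> $ j)) K = (\<Prod>j\<in>S. ((H \<odot> K) $ j) ^ (\<alpha> $ j))"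
    if "finite S" for S
    using that by (induction S) (simp_all add: subst_one subst_mult[OF assms] pow fcomp_map_def)
  from this[of UNIV] show ?thesis by (simp add: mpow_def)
qed

lemma fcomp_nth [simp]: "(F \<odot> H) $ i = mfps_subst (F $ i) H"
  by (simp add: fcomp_map_def)

lemma ord_ge_subst:
  assumes "no_const H" "ord_ge n a"
  shows "ord_ge n (mfps_subst a H)"
  unfolding ord_ge_def mcoeff_subst
proof (intro allI impI sum.neutral ballI)
  fix \<gamma> \<alpha> :: "nat ^ 'a"
  assume "mdeg \<gamma> < n" "\<alpha> \<in> {\<alpha>. mdeg \<alpha> \<le> mdeg \<gamma>}"
  then show "mcoeff a \<alpha> * mcoeff (mpow H \<alpha>) \<gamma> = 0"
    using assms(2) by (simp add: ord_ge_def)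
qed

text \<open>By linearity this reduces to \<open>a\<close> a monomial, which is multiplicativity of substitution
(\<open>subst_mpow\<close>).\<close>

lemma subst_subst:
  assumes H: "no_const H" and K: "no_const K"
  shows "mfps_subst (mfps_subst a H) K = mfps_subst a (H \<odot> K)"
proof (rule mfps_eqI)
  fix \<gamma> :: "nat ^ 'a"
  let ?D = "{\<alpha> :: nat ^ 'a. mdeg \<alpha> \<le> mdeg \<gamma>}"
  have "mcoeff (mfps_subst (mfps_subst a H) K) \<gamma> =
      (\<Sum>\<beta>\<in>?D. (\<Sum>\<alpha>\<in>?D. mcoeff a \<alpha> * mcoeff (mpow H \<alpha>) \<beta>) * mcoeff (mpow K \<beta>) \<gamma>)"
    unfolding mcoeff_subst[of _ K]
    by (intro sum.cong refl) (simp add: mcoeff_subst_upto[OF H, of _ "mdeg \<gamma>"])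
  also have "\<dots> = (\<Sum>\<alpha>\<in>?D. mcoeff a \<alpha> *
      (\<Sum>\<beta>\<in>?D. mcoeff (mpow H \<alpha>) \<beta> * mcoeff (mpow K \<beta>) \<gamma>))"
    by (simp add: sum_distrib_left sum_distrib_right mult.assoc) (rule sum.swap)
  also have "\<dots> = mcoeff (mfps_subst a (H \<odot> K)) \<gamma>"
    by (simp add: mcoeff_subst subst_mpow[OF K, symmetric])
  finally show "mcoeff (mfps_subst (mfps_subst a H) K) \<gamma> = mcoeff (mfps_subst a (H \<odot> K)) \<gamma>" .
qed

lemma fcomp_assoc: "no_const H \<Longrightarrow> no_const K \<Longrightarrow> (F \<odot> H) \<odot> K = F \<odot> (H \<odot> K)"
  by (simp add: Finite_Cartesian_Product.vec_eq_iff subst_subst)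

lemma subst_var:
  assumes "no_const K"
  shows "mfps_subst (mfps_var j) K = K $ j"
proof (rule mfps_eqI)
  fix \<gamma> :: "nat ^ 'a"
  have "mcoeff (mfps_subst (mfps_var j) K) \<gamma> = (\<Sum>\<alpha> | mdeg \<alpha> \<le> max 1 (mdeg \<gamma>).
      if \<alpha> = axis j 1 then mcoeff (mpow K \<alpha>) \<gamma> else 0)"
    unfolding mcoeff_subst_upto[OF assms max.cobounded2[of "mdeg \<gamma>" 1]] mfps_var_def mcoeff_MFPS
    by (intro sum.cong) auto
  also have "\<dots> = mcoeff (mpow K (axis j 1)) \<gamma>"
    by (simp add: finite_mdeg_le)
  finally show "mcoeff (mfps_subst (mfps_var j) K) \<gamma> = mcoeff (K $ j) \<gamma>" by (simp only: mpow_axis)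
qed

lemma linear_map_fcomp_nth:
  "no_const K \<Longrightarrow> (linear_map A \<odot> K) $ i = (\<Sum>j\<in>UNIV. mfps_const (A $ i $ j) * K $ j)"
  by (simp add: linear_map_def subst_sum subst_const_mult subst_var)

lemma linear_map_id_nth [simp]: "linear_map (mat 1) $ i = mfps_var i"
  by (rule mfps_eqI)
    (simp add: linear_map_def mcoeff_sum Finite_Cartesian_Product.mat_def mult_delta_left)

lemma linear_map_nth_homogeneous: "homogeneous 1 (linear_map A $ i)"
  by (auto simp: homogeneous_def linear_map_def mcoeff_sum mfps_var_def intro!: sum.neutral)

lemma no_const_linear_map: "no_const (linear_map A)"
  using homogeneous_imp_ord_ge linear_map_nth_homogeneous by blast

lemma linear_part_linear_map [simp]: "linear_part (linear_map A) = A"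
proof -
  have "mcoeff (linear_map A $ i) (axis j 1) = A $ i $ j" for i j
    by (simp add: linear_map_def mcoeff_sum mfps_var_def axis_eq_axis mult_delta_right)
  then show ?thesis
    by (simp add: linear_part_def)
qed

lemma linear_map_id_fcomp: "no_const F \<Longrightarrow> linear_map (mat 1) \<odot> F = F"
  by (simp add: Finite_Cartesian_Product.vec_eq_iff subst_var)

lemma mpow_linear_map_id: "mpow (linear_map (mat 1)) \<alpha> = MFPS (\<lambda>\<gamma>. if \<gamma> = \<alpha> then 1 else 0)"
proof -
  let ?M = "\<lambda>\<alpha> :: nat ^ 'a. MFPS (\<lambda>\<gamma>. if \<gamma> = \<alpha> then 1 else 0)"
  have mult: "?M \<alpha> * ?M \<beta> = ?M (\<alpha> + \<beta>)" for \<alpha> \<beta>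
  proof (rule mfps_eqI)
    fix \<gamma> :: "nat ^ 'a"
    have "mcoeff (?M \<alpha> * ?M \<beta>) \<gamma> = (\<Sum>p\<in>splits \<gamma>. if p = (\<alpha>, \<beta>) then 1 else 0)"
      unfolding mcoeff_mult by (intro sum.cong) (auto split: if_splits)
    then show "mcoeff (?M \<alpha> * ?M \<beta>) \<gamma> = mcoeff (?M (\<alpha> + \<beta>)) \<gamma>"
      by (simp add: sum.delta[OF finite_splits]) (auto simp: splits_def)
  qed
  have one: "?M 0 = 1" by (rule mfps_eqI) (simp add: mcoeff_one)
  have pow: "(mfps_var j) ^ n = ?M (axis j n)" for j n
  proof (induction n)
    case 0
    have zero: "axis j 0 = (0 :: nat ^ 'a)" by simp
    show ?case unfolding zero one by simp
  next
    case (Suc n)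
    have "axis j 1 + axis j n = (axis j (Suc n) :: nat ^ 'a)"
      by (simp add: axis_def Finite_Cartesian_Product.vec_eq_iff)
    then have "?M (axis j 1) * ?M (axis j n) = ?M (axis j (Suc n))"
      by (simp only: mult)
    then show ?case
      unfolding power_Suc Suc by (simp only: mfps_var_def)
  qed
  have "(\<Prod>j\<in>S. (mfps_var j) ^ (\<alpha> $ j)) = ?M (\<Sum>j\<in>S. axis j (\<alpha> $ j))" if "finite S" for S
    using that by (induction S) (simp_all add: one pow mult)
  from this[of UNIV] have "mpow (linear_map (mat 1)) \<alpha> = ?M (\<Sum>j\<in>UNIV. axis j (\<alpha> $ j))"
    by (simp add: mpow_def)
  also have "(\<Sum>j\<in>UNIV. axis j (\<alpha> $ j)) = \<alpha>"
    by (simp add: Finite_Cartesian_Product.vec_eq_iff axis_def)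
  finally show ?thesis .
qed

lemma fcomp_linear_map_id: "F \<odot> linear_map (mat 1) = F"
proof -
  have "mcoeff (mfps_subst (F $ i) (linear_map (mat 1))) \<gamma> = mcoeff (F $ i) \<gamma>" for i \<gamma>
    by (simp add: mcoeff_subst mpow_linear_map_id finite_mdeg_le mult_delta_right)
  then show ?thesis
    by (simp add: Finite_Cartesian_Product.vec_eq_iff mfps_eqI)
qed

lemma linear_part_fcomp:
  assumes "no_const F" "no_const H"
  shows "linear_part (F \<odot> H) = linear_part F ** linear_part H"
proof -
  have "mcoeff (mfps_subst (F $ i) H) (axis j 1)
      = (\<Sum>k\<in>UNIV. mcoeff (F $ i) (axis k 1) * mcoeff (H $ k) (axis j 1))" for i j
  proof -
    have "mcoeff (mfps_subst (F $ i) H) (axis j 1) =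
        (\<Sum>\<alpha>\<in>insert 0 (range (\<lambda>k. axis k 1)). mcoeff (F $ i) \<alpha> * mcoeff (mpow H \<alpha>) (axis j 1))"
      by (simp only: mcoeff_subst mdeg_axis mdeg_le_1)
    also have "\<dots> = (\<Sum>\<alpha>\<in>range (\<lambda>k. axis k 1).
        mcoeff (F $ i) \<alpha> * mcoeff (mpow H \<alpha>) (axis j 1))"
      using assms(1)[unfolded ord_ge_1_iff] by (intro sum.mono_neutral_right) auto
    also have "\<dots> = (\<Sum>k\<in>UNIV. mcoeff (F $ i) (axis k 1) * mcoeff (mpow H (axis k 1)) (axis j 1))"
      by (subst sum.reindex) (auto simp: inj_on_def axis_eq_axis)
    finally show ?thesis by (simp only: mpow_axis)
  qed
  then show ?thesis
    by (simp add: linear_part_def matrix_matrix_mult_def)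
qed

section \<open>The group of formal diffeomorphisms\<close>

lemma Ghat_mult [simp]: "x \<otimes>\<^bsub>Ghat\<^esub> y = x \<odot> y"
  and Ghat_one [simp]: "\<one>\<^bsub>Ghat\<^esub> = linear_map (mat 1)"
  by (simp_all add: Ghat_def)

lemma carrier_Ghat_iff: "F \<in> carrier Ghat \<longleftrightarrow> no_const F \<and> invertible (linear_part F)"
  unfolding ord_ge_1_iff by (simp add: Ghat_def formal_diffeos_def)

lemma monoid_Ghat: "monoid (Ghat :: ('n::finite mfps ^ 'n) monoid)"
proof
  fix F H :: "'n mfps ^ 'n"
  assume "F \<in> carrier Ghat" "H \<in> carrier Ghat"
  then show "F \<otimes>\<^bsub>Ghat\<^esub> H \<in> carrier Ghat"
    by (simp add: carrier_Ghat_iff ord_ge_subst linear_part_fcomp invertible_mult)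
next
  have "invertible (mat 1 :: complex ^ 'n ^ 'n)"
    by (auto simp: invertible_def)
  then show "\<one>\<^bsub>Ghat\<^esub> \<in> carrier (Ghat :: ('n mfps ^ 'n) monoid)"
    using no_const_linear_map[of "mat 1"] by (simp add: carrier_Ghat_iff)
qed (simp_all add: carrier_Ghat_iff fcomp_assoc linear_map_id_fcomp fcomp_linear_map_id)

lemma ord_ge_2_iff: "ord_ge 2 a \<longleftrightarrow> mcoeff a 0 = 0 \<and> (\<forall>j. mcoeff a (axis j 1) = 0)"
proof -
  have "ord_ge 2 a \<longleftrightarrow> (\<forall>\<gamma>\<in>{\<gamma>. mdeg \<gamma> \<le> 1}. mcoeff a \<gamma> = 0)"
    by (auto simp: ord_ge_def less_Suc_eq_le numeral_2_eq_2)
  then show ?thesis unfolding mdeg_le_1 by simp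
qed

text \<open>Tangency to the identity, in the form in which orders of vanishing can be used.\<close>

lemma Ghat0_iff: "h \<in> Ghat0 \<longleftrightarrow> (\<forall>i. ord_ge 2 (h $ i - mfps_var i))"
proof -
  have "invertible (mat 1 :: complex ^ 'n ^ 'n)"
    by (auto simp: invertible_def)
  then have "h \<in> Ghat0 \<longleftrightarrow> (\<forall>i. mcoeff (h $ i) 0 = 0) \<and> linear_part h = mat 1"
    by (auto simp: Ghat0_def Ghat_def formal_diffeos_def)
  also have "linear_part h = mat 1 \<longleftrightarrow> linear_part h = linear_part (linear_map (mat 1))"
    by simp
  also have "\<dots> \<longleftrightarrow> (\<forall>i j. mcoeff (h $ i) (axis j 1) = mcoeff (mfps_var i) (axis j 1))"
    unfolding linear_part_def linear_map_id_nth by (simp add: Finite_Cartesian_Product.vec_eq_iff)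
  finally show ?thesis
    by (auto simp: ord_ge_2_iff mfps_var_def)
qed

lemma Ghat0_carrier: "h \<in> Ghat0 \<Longrightarrow> h \<in> carrier Ghat"
  by (simp add: Ghat0_def)

lemma Ghat0_no_const: "h \<in> Ghat0 \<Longrightarrow> no_const h"
  using Ghat0_carrier carrier_Ghat_iff by blast

lemma linear_map_id_Ghat0: "linear_map (mat 1) \<in> Ghat0"
  by (simp add: Ghat0_iff)

lemma Ghat0_fcomp: "h \<in> Ghat0 \<Longrightarrow> k \<in> Ghat0 \<Longrightarrow> h \<odot> k \<in> Ghat0"
  using monoid.m_closed[OF monoid_Ghat, of h k]
  by (auto simp: Ghat0_def linear_part_fcomp carrier_Ghat_iff)

lemma subst_close:
  assumes "no_const H" "no_const K" "\<And>j. ord_ge (Suc d) (H $ j - K $ j)" "ord_ge p a"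
  shows "ord_ge (d + p) (mfps_subst a H - mfps_subst a K)"
  unfolding ord_ge_def
proof (intro allI impI)
  fix \<gamma> :: "nat ^ 'a"
  assume \<gamma>: "mdeg \<gamma> < d + p"
  have "mcoeff a \<alpha> * (mcoeff (mpow H \<alpha>) \<gamma> - mcoeff (mpow K \<alpha>) \<gamma>) = 0" for \<alpha>
  proof (cases "mdeg \<alpha> < p")
    case True
    then show ?thesis using assms(4) by (simp add: ord_ge_def)
  next
    case False
    then show ?thesis
      using mpow_close[OF assms(1-3), of \<alpha>] \<gamma> by (simp add: ord_ge_def)
  qed
  then have "(\<Sum>\<alpha> | mdeg \<alpha> \<le> mdeg \<gamma>.
      mcoeff a \<alpha> * (mcoeff (mpow H \<alpha>) \<gamma> - mcoeff (mpow K \<alpha>) \<gamma>)) = 0"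
    by (intro sum.neutral) blast
  then show "mcoeff (mfps_subst a H - mfps_subst a K) \<gamma> = 0"
    by (simp add: mcoeff_subst right_diff_distrib sum_subtractf)
qed

text \<open>The inverse of \<open>id + u\<close>, with \<open>u\<close> of order 2, is the fixed point of \<open>g \<mapsto> id - u \<odot> g\<close>. Each
iteration makes one more degree correct.\<close>

primrec inverse_approx :: "'n::finite mfps ^ 'n \<Rightarrow> nat \<Rightarrow> 'n mfps ^ 'n" where
  "inverse_approx u 0 = linear_map (mat 1)"
| "inverse_approx u (Suc k) = linear_map (mat 1) - u \<odot> inverse_approx u k"

text \<open>The coefficients of degree \<open>n\<close> of the iterates are constant from the \<open>n\<close>-th iterate on, and
these eventual values define the fixed point.\<close>

lemma order_2_fixed_point_exists:
  fixes u :: "'n::finite mfps ^ 'n"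
  assumes u: "\<And>i. ord_ge 2 (u $ i)"
  shows "\<exists>g. no_const g \<and> g = linear_map (mat 1) - u \<odot> g"
proof -
  let ?G = "inverse_approx u"
  have var: "ord_ge 1 (mfps_var i :: 'n mfps)" for i
    using no_const_linear_map[of "mat 1 :: complex ^ 'n ^ 'n"] by simp
  have u1: "no_const u"
    using u ord_ge_mono[of 2 _ 1] by auto
  have G: "no_const (?G k)" for k
  proof (induction k)
    case 0
    show ?case using var by simp
  next
    case (Suc k)
    then show ?case using var u1 by (auto intro!: ord_ge_diff ord_ge_subst)
  qed
  have step: "ord_ge (k + 2) (?G (Suc k) $ i - ?G k $ i)" for k i
  proof (induction k arbitrary: i)
    case 0
    have "ord_ge 2 (0 - mfps_subst (u $ i) (?G 0))"
      by (intro ord_ge_diff ord_ge_zero ord_ge_subst[OF G u])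
    then show ?case by (simp add: numeral_2_eq_2)
  next
    case (Suc k)
    then have "ord_ge (Suc (Suc k)) (?G (Suc k) $ j - ?G k $ j)" for j by simp
    then have "ord_ge (Suc k + 2) (mfps_subst (u $ i) (?G (Suc k)) - mfps_subst (u $ i) (?G k))"
      by (intro subst_close G u)
    from ord_ge_diff[OF ord_ge_zero this] show ?case by simp
  qed
  have cauchy: "ord_ge (k + 2) (?G l $ i - ?G k $ i)" if "k \<le> l" for k l i
    using that
  proof (induction l rule: dec_induct)
    case base
    show ?case by simp
  next
    case (step l)
    have "ord_ge (k + 2) (?G (Suc l) $ i - ?G l $ i)"
      using \<open>\<And>k i. ord_ge (k + 2) (?G (Suc k) $ i - ?G k $ i)\<close>[of l i] step.hyps
      by (auto elim: ord_ge_mono)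
    from ord_ge_add[OF this step.IH] show ?case
      by (simp only: diff_add_cancel add_diff_eq)
  qed
  define g :: "'n mfps ^ 'n" where
    "g = (\<chi> i. MFPS (\<lambda>\<gamma>. mcoeff (?G (mdeg \<gamma>) $ i) \<gamma>))"
  have close: "ord_ge (k + 2) (g $ i - ?G k $ i)" for k i
    unfolding ord_ge_def
  proof (intro allI impI)
    fix \<gamma> :: "nat ^ 'n"
    assume \<gamma>: "mdeg \<gamma> < k + 2"
    (* In degree k + 1 the iterate k is the earlier of the two, but already correct. *)
    then have "mcoeff (?G (mdeg \<gamma>) $ i) \<gamma> = mcoeff (?G k $ i) \<gamma>"
      using cauchy[of "mdeg \<gamma>" k i] cauchy[of k "mdeg \<gamma>" i]
      by (cases "mdeg \<gamma> \<le> k") (auto simp: ord_ge_def)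
    then show "mcoeff (g $ i - ?G k $ i) \<gamma> = 0" by (simp add: g_def)
  qed
  have g: "no_const g"
  proof
    fix i
    have "ord_ge 1 (g $ i - ?G 0 $ i)" using close[of 0 i] by (auto elim: ord_ge_mono)
    from ord_ge_add[OF this, of "?G 0 $ i"] show "ord_ge 1 (g $ i)" using G[of 0] by simp
  qed
  have "mcoeff (g $ i) \<gamma> = mcoeff ((linear_map (mat 1) - u \<odot> g) $ i) \<gamma>" for i \<gamma>
  proof -
    let ?k = "mdeg \<gamma>"
    have "ord_ge (Suc ?k + 2) (mfps_subst (u $ i) g - mfps_subst (u $ i) (?G ?k))"
      using close[of ?k] by (intro subst_close g G u) simp
    moreover have "mcoeff (g $ i) \<gamma> = mcoeff (?G (Suc ?k) $ i) \<gamma>"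
      using close[of "Suc ?k" i] by (simp add: ord_ge_def)
    ultimately show ?thesis by (simp add: ord_ge_def)
  qed
  then have "g = linear_map (mat 1) - u \<odot> g"
    by (auto simp: Finite_Cartesian_Product.vec_eq_iff intro: mfps_eqI)
  with g show ?thesis by blast
qed

lemma fcomp_diff: "(F - G) \<odot> H = F \<odot> H - G \<odot> H"
  by (simp add: Finite_Cartesian_Product.vec_eq_iff subst_diff)

lemma Ghat0_right_inverse_exists:
  assumes "h \<in> Ghat0"
  shows "\<exists>g\<in>Ghat0. h \<odot> g = linear_map (mat 1)"
proof -
  let ?u = "h - linear_map (mat 1)"
  have u: "ord_ge 2 (?u $ i)" for i
    using assms by (simp add: Ghat0_iff)
  then obtain g where g: "no_const g" and fixpoint: "g = linear_map (mat 1) - ?u \<odot> g"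
    using order_2_fixed_point_exists by blast
  have "h \<odot> g - g = ?u \<odot> g"
    using g by (simp add: fcomp_diff linear_map_id_fcomp)
  also have "\<dots> = linear_map (mat 1) - (linear_map (mat 1) - ?u \<odot> g)" by simp
  also have "\<dots> = linear_map (mat 1) - g" by (simp only: fixpoint[symmetric])
  finally have "h \<odot> g = linear_map (mat 1)" by simp
  moreover have "g \<in> Ghat0"
    unfolding Ghat0_iff
  proof
    fix i
    have "ord_ge 2 (0 - mfps_subst (?u $ i) g)"
      by (rule ord_ge_diff[OF ord_ge_zero ord_ge_subst[OF g u]])
    moreover have "g $ i = mfps_var i - mfps_subst (?u $ i) g"
      by (subst fixpoint) simp
    ultimately show "ord_ge 2 (g $ i - mfps_var i)" by simp
  qed
  ultimately show ?thesis by blast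
qed

text \<open>Every element of \<open>Ghat0\<close> has a right inverse in \<open>Ghat0\<close>, hence so has that right inverse; associativity makes
both two-sided. The inverse taken in \<open>Ghat\<close> is therefore the one in \<open>Ghat0\<close>.\<close>

lemma Ghat0_inverse:
  assumes "h \<in> Ghat0"
  shows "inv\<^bsub>Ghat\<^esub> h \<in> Ghat0" "h \<odot> inv\<^bsub>Ghat\<^esub> h = linear_map (mat 1)"
    "inv\<^bsub>Ghat\<^esub> h \<odot> h = linear_map (mat 1)"
proof -
  obtain g where g: "g \<in> Ghat0" and hg: "h \<odot> g = linear_map (mat 1)"
    using Ghat0_right_inverse_exists[OF assms] by blast
  obtain h' where h': "h' \<in> Ghat0" and gh': "g \<odot> h' = linear_map (mat 1)"
    using Ghat0_right_inverse_exists[OF g] by blast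
  have "h = (h \<odot> g) \<odot> h'"
    using Ghat0_no_const[OF g] Ghat0_no_const[OF h']
    by (simp add: fcomp_assoc gh' fcomp_linear_map_id)
  also have "\<dots> = h'"
    using Ghat0_no_const[OF h'] by (simp add: hg linear_map_id_fcomp)
  finally have gh: "g \<odot> h = linear_map (mat 1)" using gh' by simp
  have "inv\<^bsub>Ghat\<^esub> h = g"
    using monoid.inv_char[OF monoid_Ghat, of h g] assms g hg gh by (simp add: Ghat0_carrier)
  with g hg gh show "inv\<^bsub>Ghat\<^esub> h \<in> Ghat0" "h \<odot> inv\<^bsub>Ghat\<^esub> h = linear_map (mat 1)"
    "inv\<^bsub>Ghat\<^esub> h \<odot> h = linear_map (mat 1)" by auto
qed

section \<open>Linearizations as an orbit of the centralizer\<close>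

lemma formal_linearizations_iff:
  assumes "f \<in> carrier Ghat"
  shows "h \<in> formal_linearizations f \<longleftrightarrow>
    h \<in> Ghat0 \<and> h \<odot> f = linear_map (linear_part f) \<odot> h"
proof (cases "h \<in> Ghat0")
  case True
  note inv = Ghat0_inverse[OF True]
  have f: "no_const f" using assms by (simp add: carrier_Ghat_iff)
  have h: "no_const h" and h': "no_const (inv\<^bsub>Ghat\<^esub> h)"
    using True inv(1) Ghat0_no_const by blast+
  have "h \<odot> f = linear_map (linear_part f) \<odot> h"
    if "h \<odot> f \<odot> inv\<^bsub>Ghat\<^esub> h = linear_map (linear_part f)"
  proof -
    have "h \<odot> f \<odot> inv\<^bsub>Ghat\<^esub> h \<odot> h = h \<odot> f"
      using h h' by (simp add: fcomp_assoc inv(3) fcomp_linear_map_id)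
    with that show ?thesis by simp
  qed
  moreover have "h \<odot> f \<odot> inv\<^bsub>Ghat\<^esub> h = linear_map (linear_part f)"
    if "h \<odot> f = linear_map (linear_part f) \<odot> h"
    using h h' by (simp add: that fcomp_assoc inv(2) fcomp_linear_map_id)
  ultimately show ?thesis
    using True by (auto simp: formal_linearizations_def)
qed (simp add: formal_linearizations_def)

lemma formal_centralizer_iff:
  "k \<in> formal_centralizer A \<longleftrightarrow> k \<in> Ghat0 \<and> k \<odot> linear_map A = linear_map A \<odot> k"
  by (simp add: formal_centralizer_def)

lemma centralizer_fcomp_linearization:
  assumes f: "f \<in> carrier Ghat" and h: "h \<in> formal_linearizations f"
    and k: "k \<in> formal_centralizer (linear_part f)"
  shows "k \<odot> h \<in> formal_linearizations f"
proof -
  let ?A = "linear_map (linear_part f)"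
  have G: "h \<in> Ghat0" "k \<in> Ghat0"
    using h k by (auto simp: formal_linearizations_iff[OF f] formal_centralizer_iff)
  note nc = Ghat0_no_const[OF G(1)] Ghat0_no_const[OF G(2)] no_const_linear_map[of "linear_part f"]
  have "no_const f" using f by (simp add: carrier_Ghat_iff)
  then have "(k \<odot> h) \<odot> f = k \<odot> (?A \<odot> h)"
    using h nc by (simp add: fcomp_assoc formal_linearizations_iff[OF f])
  also have "\<dots> = ?A \<odot> (k \<odot> h)"
    using k nc by (simp add: fcomp_assoc[symmetric] formal_centralizer_iff)
  finally show ?thesis
    using G by (simp add: formal_linearizations_iff[OF f] Ghat0_fcomp)
qed

text \<open>Here \<open>h0\<^bsup>-1\<^esup> \<odot> A = f \<odot> h0\<^bsup>-1\<^esup>\<close>, so that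
\<open>h \<odot> h0\<^bsup>-1\<^esup> \<odot> A = h \<odot> f \<odot> h0\<^bsup>-1\<^esup> = A \<odot> h \<odot> h0\<^bsup>-1\<^esup>\<close>.\<close>

lemma linearization_quotient_centralizer:
  assumes f: "f \<in> carrier Ghat"
    and h: "h \<in> formal_linearizations f" and h0: "h0 \<in> formal_linearizations f"
  shows "h \<odot> inv\<^bsub>Ghat\<^esub> h0 \<in> formal_centralizer (linear_part f)"
proof -
  let ?A = "linear_map (linear_part f)" and ?g = "inv\<^bsub>Ghat\<^esub> h0"
  have G: "h \<in> Ghat0" "h0 \<in> Ghat0" and lin: "h \<odot> f = ?A \<odot> h" "h0 \<odot> f = ?A \<odot> h0"
    using h h0 by (auto simp: formal_linearizations_iff[OF f])
  note inv = Ghat0_inverse[OF G(2)]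
  note nc = Ghat0_no_const[OF G(1)] Ghat0_no_const[OF G(2)] Ghat0_no_const[OF inv(1)]
    no_const_linear_map[of "linear_part f"]
  have ncf: "no_const f" using f by (simp add: carrier_Ghat_iff)
  have "?g \<odot> ?A = ?g \<odot> (?A \<odot> (h0 \<odot> ?g))"
    by (simp add: inv fcomp_linear_map_id)
  also have "\<dots> = ?g \<odot> (h0 \<odot> f) \<odot> ?g"
    using nc ncf by (simp add: lin fcomp_assoc ord_ge_subst)
  also have "\<dots> = (?g \<odot> h0) \<odot> (f \<odot> ?g)"
    using nc ncf by (simp add: fcomp_assoc ord_ge_subst)
  also have "\<dots> = f \<odot> ?g"
    using nc ncf by (simp add: inv linear_map_id_fcomp ord_ge_subst)
  finally have "(h \<odot> ?g) \<odot> ?A = (h \<odot> f) \<odot> ?g"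
    using nc ncf by (simp add: fcomp_assoc)
  also have "\<dots> = ?A \<odot> (h \<odot> ?g)"
    using nc by (simp add: lin fcomp_assoc)
  finally show ?thesis
    using G inv(1) by (simp add: formal_centralizer_iff Ghat0_fcomp)
qed

lemma Ghat0_fcomp_inverse_cancel:
  assumes "h0 \<in> Ghat0" "no_const h"
  shows "h \<odot> inv\<^bsub>Ghat\<^esub> h0 \<odot> h0 = h" "h \<odot> h0 \<odot> inv\<^bsub>Ghat\<^esub> h0 = h"
  using Ghat0_inverse[OF assms(1)] Ghat0_no_const[OF assms(1)]
    Ghat0_no_const[OF Ghat0_inverse(1)[OF assms(1)]] assms(2)
  by (simp_all add: fcomp_assoc fcomp_linear_map_id)

section \<open>Jets\<close>

lemma mcoeff_jet: "mcoeff (jet m F $ i) \<alpha> = (if mdeg \<alpha> \<le> m then mcoeff (F $ i) \<alpha> else 0)"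
  by (simp add: jet_def)

lemma jet_eq_iff: "jet m F = jet m G \<longleftrightarrow> (\<forall>i. ord_ge (Suc m) (F $ i - G $ i))"
proof -
  have "jet m F = jet m G \<longleftrightarrow> (\<forall>i \<alpha>. mcoeff (jet m F $ i) \<alpha> = mcoeff (jet m G $ i) \<alpha>)"
    by (auto simp: Finite_Cartesian_Product.vec_eq_iff intro: mfps_eqI)
  then show ?thesis by (simp add: mcoeff_jet ord_ge_def less_Suc_eq_le)
qed

lemma jet_jet: "jet m (jet m F) = jet m F"
  by (simp add: jet_eq_iff ord_ge_def mcoeff_jet less_Suc_eq_le)

lemma jet_fcomp_cong:
  assumes "no_const H" "jet m F = jet m G"
  shows "jet m (F \<odot> H) = jet m (G \<odot> H)"
  using assms by (simp add: jet_eq_iff subst_diff[symmetric] ord_ge_subst)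

lemma jet_Ghat0:
  assumes "m \<ge> 1" "h \<in> Ghat0"
  shows "jet m h \<in> Ghat0"
proof -
  have "ord_ge 2 (h $ i - mfps_var i)" for i using assms(2) by (simp add: Ghat0_iff)
  then show ?thesis using assms(1) by (simp add: Ghat0_iff ord_ge_def mcoeff_jet)
qed

lemma jet_linear_map_fcomp:
  assumes "no_const K"
  shows "jet m (linear_map A \<odot> K) = linear_map A \<odot> jet m K"
proof -
  have "no_const (jet m K)" using assms by (simp add: ord_ge_def mcoeff_jet)
  then have "mcoeff (jet m (linear_map A \<odot> K) $ i) \<alpha> = mcoeff ((linear_map A \<odot> jet m K) $ i) \<alpha>"
    for i \<alpha>
    using assms by (simp add: mcoeff_jet linear_map_fcomp_nth mcoeff_sum del: fcomp_nth)
  then show ?thesis by (auto simp: Finite_Cartesian_Product.vec_eq_iff intro: mfps_eqI)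
qed

text \<open>The monomials of a linear map are homogeneous, so the coefficients of degree \<open>n\<close> of
\<open>K \<odot> linear_map A\<close> come from those of degree \<open>n\<close> of \<open>K\<close>.\<close>

lemma jet_fcomp_linear_map: "jet m (K \<odot> linear_map A) = jet m K \<odot> linear_map A"
proof -
  have vanish: "mcoeff (mpow (linear_map A) \<alpha>) \<gamma> = 0" if "mdeg \<alpha> \<noteq> mdeg \<gamma>" for \<alpha> \<gamma> :: "nat ^ 'a"
    using homogeneous_mpow[of "linear_map A" \<alpha>] linear_map_nth_homogeneous[of A] that
    by (auto simp: homogeneous_def)
  have "mcoeff (jet m (K \<odot> linear_map A) $ i) \<gamma> = mcoeff ((jet m K \<odot> linear_map A) $ i) \<gamma>"
    for i \<gamma>
  proof -
    have "mcoeff ((jet m K \<odot> linear_map A) $ i) \<gamma> = (\<Sum>\<alpha> | mdeg \<alpha> \<le> mdeg \<gamma>.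
        if mdeg \<gamma> \<le> m then mcoeff (K $ i) \<alpha> * mcoeff (mpow (linear_map A) \<alpha>) \<gamma> else 0)"
      unfolding fcomp_nth mcoeff_subst mcoeff_jet
    proof (rule sum.cong[OF refl])
      fix \<alpha> :: "nat ^ 'a"
      show "(if mdeg \<alpha> \<le> m then mcoeff (K $ i) \<alpha> else 0) * mcoeff (mpow (linear_map A) \<alpha>) \<gamma>
          = (if mdeg \<gamma> \<le> m then mcoeff (K $ i) \<alpha> * mcoeff (mpow (linear_map A) \<alpha>) \<gamma> else 0)"
        using vanish[of \<alpha> \<gamma>] by (cases "mdeg \<alpha> = mdeg \<gamma>") auto
    qed
    then show ?thesis by (simp add: mcoeff_jet mcoeff_subst)
  qed
  then show ?thesis by (auto simp: Finite_Cartesian_Product.vec_eq_iff intro: mfps_eqI)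
qed

text \<open>The point where linearity of \<open>A\<close> enters: truncation commutes with composition with \<open>A\<close> on either
side. The bound on \<open>m\<close> keeps the linear part.\<close>

lemma jet_formal_centralizer:
  assumes "m \<ge> 1" "k \<in> formal_centralizer A"
  shows "jet m k \<in> formal_centralizer A"
  using assms Ghat0_no_const[of k]
  by (auto simp: formal_centralizer_iff jet_Ghat0 jet_fcomp_linear_map[symmetric]
      jet_linear_map_fcomp[symmetric])

lemma cscale_nth: "cscale c F $ i = mfps_const c * F $ i"
  by (rule mfps_eqI) (simp add: cscale_def)

lemma cscale_fcomp: "cscale c F \<odot> H = cscale c (F \<odot> H)"
  and add_fcomp: "(F + G) \<odot> H = F \<odot> H + G \<odot> H"
  by (simp_all add: Finite_Cartesian_Product.vec_eq_iff cscale_nth subst_const_mult subst_add)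

lemma Ghat0_affine:
  assumes "h \<in> Ghat0" "k \<in> Ghat0" "a + b = 1"
  shows "cscale a h + cscale b k \<in> Ghat0"
  unfolding Ghat0_iff
proof (intro allI, unfold ord_ge_def, intro allI impI)
  fix i and \<gamma> :: "nat ^ 'a"
  assume "mdeg \<gamma> < 2"
  then have "mcoeff (h $ i) \<gamma> = mcoeff (mfps_var i) \<gamma>" "mcoeff (k $ i) \<gamma> = mcoeff (mfps_var i) \<gamma>"
    using assms(1,2) by (auto simp: Ghat0_iff ord_ge_def)
  then show "mcoeff ((cscale a h + cscale b k) $ i - mfps_var i) \<gamma> = 0"
    using assms(3) by (simp add: cscale_nth distrib_right[symmetric])
qed

lemma linear_map_fcomp_affine:
  assumes "no_const h" "no_const k"
  shows "linear_map A \<odot> (cscale a h + cscale b k)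
    = cscale a (linear_map A \<odot> h) + cscale b (linear_map A \<odot> k)"
proof -
  have "no_const (cscale a h + cscale b k)"
    using assms by (simp add: cscale_nth ord_ge_def)
  then show ?thesis using assms
    by (simp add: Finite_Cartesian_Product.vec_eq_iff cscale_nth linear_map_fcomp_nth
        sum_distrib_left sum.distrib algebra_simps del: fcomp_nth)
qed

text \<open>Composition is linear in its left factor, and in its right factor when the left one is a linear map.
Only affine combinations preserve the linear part.\<close>

lemma formal_centralizer_affine:
  assumes "h \<in> formal_centralizer A" "k \<in> formal_centralizer A" "a + b = 1"
  shows "cscale a h + cscale b k \<in> formal_centralizer A"
  using assms Ghat0_no_const[of h] Ghat0_no_const[of k]
  by (simp add: formal_centralizer_iff Ghat0_affine linear_map_fcomp_affine add_fcomp cscale_fcomp)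

lemma id_formal_centralizer: "linear_map (mat 1) \<in> formal_centralizer A"
  by (simp add: formal_centralizer_iff linear_map_id_Ghat0 fcomp_linear_map_id
      linear_map_id_fcomp[OF no_const_linear_map])

section \<open>Coordinates on the jets of linearizations\<close>

lemma mcoeff_jet_vector:
  "mcoeff (jet_vector m F $ i) \<alpha> = (if 2 \<le> mdeg \<alpha> \<and> mdeg \<alpha> \<le> m then mcoeff (F $ i) \<alpha> else 0)"
  by (simp add: jet_vector_def)

lemma tuple_eqI: "(\<And>i \<alpha>. mcoeff (F $ i) \<alpha> = mcoeff (G $ i) \<alpha>) \<Longrightarrow> F = G"
  by (auto simp: Finite_Cartesian_Product.vec_eq_iff intro: mfps_eqI)

lemma jet_vector_add: "jet_vector m (F + G) = jet_vector m F + jet_vector m G"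
  and jet_vector_cscale: "jet_vector m (cscale c F) = cscale c (jet_vector m F)"
  and jet_add: "jet m (F + G) = jet m F + jet m G"
  and jet_cscale: "jet m (cscale c F) = cscale c (jet m F)"
  by (auto intro!: tuple_eqI simp: mcoeff_jet_vector mcoeff_jet cscale_nth)

lemma jet_vector_id: "jet_vector m (linear_map (mat 1)) = 0"
proof (rule tuple_eqI)
  fix i and \<alpha> :: "nat ^ 'a"
  show "mcoeff (jet_vector m (linear_map (mat 1)) $ i) \<alpha> = mcoeff (0 $ i) \<alpha>"
    using linear_map_nth_homogeneous[of "mat 1" i]
    by (simp add: mcoeff_jet_vector homogeneous_def)
qed

text \<open>On \<open>Ghat0\<close> the coefficients of degree at most 1 are fixed.\<close>

lemma jet_vector_eq_iff_jet_eq: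
  assumes "h \<in> Ghat0" "k \<in> Ghat0"
  shows "jet_vector m h = jet_vector m k \<longleftrightarrow> jet m h = jet m k"
proof -
  have low: "mcoeff (h $ i) \<alpha> = mcoeff (k $ i) \<alpha>" if "mdeg \<alpha> < 2" for i \<alpha>
    using assms that by (auto simp: Ghat0_iff ord_ge_def)
  have "jet_vector m h = jet_vector m k \<longleftrightarrow>
      (\<forall>i \<alpha>. mcoeff (jet_vector m h $ i) \<alpha> = mcoeff (jet_vector m k $ i) \<alpha>)"
    by (auto intro: tuple_eqI)
  also have "\<dots> \<longleftrightarrow> (\<forall>i \<alpha>. mdeg \<alpha> \<le> m \<longrightarrow> mcoeff (h $ i) \<alpha> = mcoeff (k $ i) \<alpha>)"
  proof (intro arg_cong[where f = All] ext)
    fix i and \<alpha> :: "nat ^ 'a"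
    show "mcoeff (jet_vector m h $ i) \<alpha> = mcoeff (jet_vector m k $ i) \<alpha> \<longleftrightarrow>
        (mdeg \<alpha> \<le> m \<longrightarrow> mcoeff (h $ i) \<alpha> = mcoeff (k $ i) \<alpha>)"
      using low[of \<alpha> i] by (cases "mdeg \<alpha> < 2") (auto simp: mcoeff_jet_vector)
  qed
  finally show ?thesis by (simp add: jet_eq_iff ord_ge_def less_Suc_eq_le)
qed

text \<open>Dropping the linear part maps the affine space of centralizing tuples onto a linear space, since the
identity centralizes \<open>A\<close> and is mapped to \<open>0\<close>.\<close>

lemma jet_vector_centralizer_subspace:
  "module.subspace cscale (jet_vector m ` formal_centralizer A)"
proof -
  interpret V: vector_space "cscale :: complex \<Rightarrow> 'a mfps ^ 'a \<Rightarrow> _"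
    by (rule vector_space_cscale)
  let ?C = "formal_centralizer A" and ?id = "linear_map (mat 1) :: 'a mfps ^ 'a"
  have scale: "cscale c (jet_vector m k) \<in> jet_vector m ` ?C" if "k \<in> ?C" for c k
  proof -
    have "cscale c k + cscale (1 - c) ?id \<in> ?C"
      by (intro formal_centralizer_affine that id_formal_centralizer) simp
    moreover have "jet_vector m (cscale c k + cscale (1 - c) ?id) = cscale c (jet_vector m k)"
      by (simp add: jet_vector_add jet_vector_cscale jet_vector_id)
    ultimately show ?thesis by (metis image_eqI)
  qed
  show ?thesis
  proof (rule V.subspaceI)
    show "0 \<in> jet_vector m ` ?C"
      using id_formal_centralizer jet_vector_id by (metis image_eqI)
  next
    fix x y
    assume "x \<in> jet_vector m ` ?C" "y \<in> jet_vector m ` ?C"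
    then obtain h k where hk: "h \<in> ?C" "k \<in> ?C" "x = jet_vector m h" "y = jet_vector m k"
      by blast
    (* A sum is not an affine combination, but twice a midpoint is a multiple of one. *)
    have mid: "cscale (1/2) h + cscale (1/2) k \<in> ?C"
      by (intro formal_centralizer_affine hk) simp
    have "x + y = cscale 2 (jet_vector m (cscale (1/2) h + cscale (1/2) k))"
      by (simp add: hk jet_vector_add jet_vector_cscale V.scale_right_distrib)
    then show "x + y \<in> jet_vector m ` ?C" using scale[OF mid] by simp
  qed (use scale in auto)
qed

text \<open>Enumerating a basis gives the coordinates; the finite spanning set only ensures that a basis is
finite.\<close>

lemma linear_iso_on_Cspace_exists:
  fixes V :: "('n::finite mfps ^ 'n) set"
  assumes sub: "module.subspace cscale V"
    and fin: "finite S" "V \<subseteq> module.span cscale S"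
  shows "\<exists>L. linear_iso_on (Cspace (vector_space.dim cscale V)) V L"
proof -
  interpret V: vector_space "cscale :: complex \<Rightarrow> 'n mfps ^ 'n \<Rightarrow> _"
    by (rule vector_space_cscale)
  obtain B where B: "B \<subseteq> V" "V.independent B" "V \<subseteq> V.span B" "card B = V.dim V"
    using V.basis_exists by blast
  have finB: "finite B"
    using V.independent_span_bound[OF fin(1) B(2)] B(1) fin(2) by blast
  define d where "d = V.dim V"
  obtain b where b: "bij_betw b {..<d} B"
    using ex_bij_betw_nat_finite[OF finB] B(4) by (auto simp: d_def atLeast0LessThan)
  define L where "L = (\<lambda>s. \<Sum>i<d. cscale (s i) (b i))"
  have reindex: "L s = (\<Sum>v\<in>B. cscale (s (the_inv_into {..<d} b v)) v)" for s
  proof -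
    have "L s = (\<Sum>i<d. cscale (s (the_inv_into {..<d} b (b i))) (b i))"
      unfolding L_def using b by (intro sum.cong) (auto simp: bij_betw_def the_inv_into_f_f)
    also have "\<dots> = (\<Sum>v\<in>B. cscale (s (the_inv_into {..<d} b v)) v)"
      by (rule sum.reindex_bij_betw[OF b])
    finally show ?thesis .
  qed
  have "inj_on L (Cspace d)"
  proof
    fix s t
    assume st: "s \<in> Cspace d" "t \<in> Cspace d" and "L s = L t"
    then have "(\<Sum>v\<in>B. cscale (s (the_inv_into {..<d} b v) - t (the_inv_into {..<d} b v)) v) = 0"
      by (simp add: reindex V.scale_left_diff_distrib sum_subtractf)
    then have zero: "s (the_inv_into {..<d} b v) - t (the_inv_into {..<d} b v) = 0" if "v \<in> B" for v
      using V.independentD[OF B(2) finB subset_refl _ that,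
          of "\<lambda>v. s (the_inv_into {..<d} b v) - t (the_inv_into {..<d} b v)"] by blast
    have "s i = t i" for i
    proof (cases "i < d")
      case True
      then have "b i \<in> B" "the_inv_into {..<d} b (b i) = i"
        using b by (auto simp: bij_betw_def the_inv_into_f_f)
      then show ?thesis using zero[of "b i"] by simp
    next
      case False
      then show ?thesis using st by (simp add: Cspace_def)
    qed
    then show "s = t" by blast
  qed
  moreover have "L ` Cspace d = V"
  proof (intro equalityI subsetI)
    fix v
    assume "v \<in> L ` Cspace d"
    moreover have "L s \<in> V" for s
      unfolding L_def
      by (intro V.subspace_sum[OF sub] V.subspace_scale[OF sub])
        (use b B(1) in \<open>auto simp: bij_betw_def\<close>)
    ultimately show "v \<in> V" by blast
  next
    fix v
    assume "v \<in> V"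
    then have "v \<in> V.span B" using B(3) by blast
    then obtain u where u: "v = (\<Sum>w\<in>B. cscale (u w) w)"
      unfolding V.span_finite[OF finB] by blast
    let ?s = "\<lambda>i. if i < d then u (b i) else 0"
    have "L ?s = (\<Sum>i<d. cscale (u (b i)) (b i))"
      unfolding L_def by (intro sum.cong) auto
    also have "\<dots> = v"
      unfolding u by (rule sum.reindex_bij_betw[OF b])
    finally have "L ?s = v" .
    moreover have "?s \<in> Cspace d" by (simp add: Cspace_def)
    ultimately show "v \<in> L ` Cspace d" by blast
  qed
  ultimately have "bij_betw L (Cspace d) V" by (simp add: bij_betw_def)
  moreover have "L (\<lambda>i. s i + t i) = L s + L t" for s t
    by (simp add: L_def V.scale_left_distrib sum.distrib)
  moreover have "L (\<lambda>i. c * s i) = cscale c (L s)" for c s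
    by (simp add: L_def V.scale_sum_right)
  ultimately show ?thesis
    unfolding linear_iso_on_def d_def by blast
qed

definition monomial_tuple :: "'n \<Rightarrow> nat ^ 'n \<Rightarrow> 'n::finite mfps ^ 'n" where
  "monomial_tuple i \<alpha> = (\<chi> j. MFPS (\<lambda>\<beta>. if j = i \<and> \<beta> = \<alpha> then 1 else 0))"

lemma jet_vector_in_span_monomials:
  "jet_vector m F \<in> module.span cscale
     ((\<lambda>(i, \<alpha>). monomial_tuple i \<alpha>) ` (UNIV \<times> {\<alpha>. mdeg \<alpha> \<le> m}))"
proof -
  interpret V: vector_space "cscale :: complex \<Rightarrow> 'a mfps ^ 'a \<Rightarrow> _"
    by (rule vector_space_cscale)
  let ?D = "{\<alpha> :: nat ^ 'a. mdeg \<alpha> \<le> m}" and ?v = "jet_vector m F"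
  have "?v = (\<Sum>(i, \<alpha>)\<in>UNIV \<times> ?D. cscale (mcoeff (?v $ i) \<alpha>) (monomial_tuple i \<alpha>))"
  proof (rule tuple_eqI)
    fix j and \<beta> :: "nat ^ 'a"
    have "mcoeff ((\<Sum>(i, \<alpha>)\<in>UNIV \<times> ?D. cscale (mcoeff (?v $ i) \<alpha>) (monomial_tuple i \<alpha>)) $ j) \<beta>
        = (\<Sum>p\<in>UNIV \<times> ?D. if p = (j, \<beta>) then mcoeff (?v $ j) \<beta> else 0)"
      by (auto simp: mcoeff_sum cscale_nth monomial_tuple_def intro!: sum.cong)
    also have "\<dots> = mcoeff (?v $ j) \<beta>"
      by (subst sum.delta) (auto simp: finite_mdeg_le mcoeff_jet_vector)
    finally show "mcoeff (?v $ j) \<beta> = mcoeff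
        ((\<Sum>(i, \<alpha>)\<in>UNIV \<times> ?D. cscale (mcoeff (?v $ i) \<alpha>) (monomial_tuple i \<alpha>)) $ j) \<beta>" ..
  qed
  also have "\<dots> \<in> V.span ((\<lambda>(i, \<alpha>). monomial_tuple i \<alpha>) ` (UNIV \<times> ?D))"
    by (rule V.span_sum, clarify, rule V.span_scale, rule V.span_base) auto
  finally show ?thesis .
qed

text \<open>The choice of \<open>k\<close> is harmless: its jet vector determines its \<open>m\<close>-jet, and this determines the
\<open>m\<close>-jet of \<open>k \<odot> h0\<close>.\<close>

lemma jet_identification_exists: "\<exists>\<phi>. jet_identification A h0 m \<phi>" if h0: "h0 \<in> Ghat0"
proof -
  let ?C = "formal_centralizer A"
  obtain L where L: "linear_iso_on (Cspace (centralizer_dim A m)) (jet_vector m ` ?C) L"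
    using linear_iso_on_Cspace_exists[OF jet_vector_centralizer_subspace,
        of "(\<lambda>(i, \<alpha>). monomial_tuple i \<alpha>) ` (UNIV \<times> {\<alpha>. mdeg \<alpha> \<le> m})" m A]
      jet_vector_in_span_monomials
    by (auto simp: centralizer_dim_def finite_mdeg_le)
  define \<phi> where "\<phi> = (\<lambda>s. jet m ((SOME k. k \<in> ?C \<and> jet_vector m k = L s) \<odot> h0))"
  have "\<phi> s = jet m (k \<odot> h0)" if k: "k \<in> ?C" "jet_vector m k = L s" for s k
  proof -
    let ?k = "SOME k. k \<in> ?C \<and> jet_vector m k = L s"
    have "?k \<in> ?C \<and> jet_vector m ?k = L s" by (rule someI) (use k in blast)
    then have "jet m ?k = jet m k"
      using k jet_vector_eq_iff_jet_eq[of ?k k m] by (simp add: formal_centralizer_iff)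
    then show ?thesis
      unfolding \<phi>_def using jet_fcomp_cong Ghat0_no_const[OF h0] by blast
  qed
  then show ?thesis
    using L unfolding jet_identification_def by auto
qed

text \<open>Injectivity comes from composing with the inverse of \<open>h0\<close>, surjectivity from
\<open>linearization_quotient_centralizer\<close>, and affinity from linearity of composition in its left
factor.\<close>

lemma jet_identification_affine_iso:
  assumes f: "f \<in> carrier Ghat" and h0: "h0 \<in> formal_linearizations f"
    and id: "jet_identification (linear_part f) h0 m \<phi>"
  shows "affine_iso_on (Cspace (centralizer_dim (linear_part f) m))
    (jet m ` formal_linearizations f) \<phi>"
proof -
  let ?A = "linear_part f" and ?g = "inv\<^bsub>Ghat\<^esub> h0"
  let ?C = "formal_centralizer ?A" and ?S = "Cspace (centralizer_dim ?A m)"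
  have h0': "h0 \<in> Ghat0" using h0 by (simp add: formal_linearizations_iff[OF f])
  note nc = Ghat0_no_const[OF h0'] Ghat0_no_const[OF Ghat0_inverse(1)[OF h0']]
  obtain L where L: "bij_betw L ?S (jet_vector m ` ?C)"
    and add: "\<And>x y. x \<in> ?S \<Longrightarrow> y \<in> ?S \<Longrightarrow> L (\<lambda>i. x i + y i) = L x + L y"
    and scale: "\<And>c x. x \<in> ?S \<Longrightarrow> L (\<lambda>i. c * x i) = cscale c (L x)"
    and \<phi>: "\<And>s k. s \<in> ?S \<Longrightarrow> k \<in> ?C \<Longrightarrow> jet_vector m k = L s \<Longrightarrow> \<phi> s = jet m (k \<odot> h0)"
    using id unfolding jet_identification_def linear_iso_on_def by auto
  have rep: "\<exists>k\<in>?C. jet_vector m k = L s \<and> \<phi> s = jet m (k \<odot> h0)" if "s \<in> ?S" for s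
    using bij_betw_apply[OF L that] \<phi>[OF that] by auto
  have "inj_on \<phi> ?S"
  proof
    fix s t
    assume st: "s \<in> ?S" "t \<in> ?S" "\<phi> s = \<phi> t"
    obtain k l where k: "k \<in> ?C" "jet_vector m k = L s" "\<phi> s = jet m (k \<odot> h0)"
      and l: "l \<in> ?C" "jet_vector m l = L t" "\<phi> t = jet m (l \<odot> h0)"
      using rep st(1,2) by blast
    have kl: "k \<in> Ghat0" "l \<in> Ghat0" using k(1) l(1) by (simp_all add: formal_centralizer_iff)
    have "jet m (k \<odot> h0 \<odot> ?g) = jet m (l \<odot> h0 \<odot> ?g)"
      by (rule jet_fcomp_cong[OF nc(2)]) (use st(3) k(3) l(3) in simp)
    then have "jet m k = jet m l"
      using Ghat0_fcomp_inverse_cancel(2)[OF h0'] kl Ghat0_no_const by metis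
    then have "L s = L t"
      using jet_vector_eq_iff_jet_eq[OF kl, of m] k(2) l(2) by simp
    then show "s = t" using L st(1,2) by (auto simp: bij_betw_def inj_on_def)
  qed
  moreover have "\<phi> ` ?S = jet m ` formal_linearizations f"
  proof (intro equalityI subsetI)
    fix x
    assume "x \<in> \<phi> ` ?S"
    then obtain s where s: "s \<in> ?S" "x = \<phi> s" by blast
    then obtain k where "k \<in> ?C" "\<phi> s = jet m (k \<odot> h0)" using rep by blast
    then show "x \<in> jet m ` formal_linearizations f"
      using centralizer_fcomp_linearization[OF f h0] s by blast
  next
    fix x
    assume "x \<in> jet m ` formal_linearizations f"
    then obtain h where h: "h \<in> formal_linearizations f" "x = jet m h" by blast
    let ?k = "h \<odot> ?g"
    have k: "?k \<in> ?C" by (rule linearization_quotient_centralizer[OF f h(1) h0])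
    have "?k \<odot> h0 = h"
      using h(1) Ghat0_fcomp_inverse_cancel(1)[OF h0'] Ghat0_no_const
      by (metis formal_linearizations_iff[OF f])
    moreover obtain s where "s \<in> ?S" "L s = jet_vector m ?k"
      using L k by (metis bij_betw_imp_surj_on imageE imageI)
    ultimately show "x \<in> \<phi> ` ?S"
      using \<phi>[of s ?k] k h(2) by (metis imageI)
  qed
  moreover have "\<phi> (\<lambda>i. (1 - t) * x i + t * y i) = cscale (1 - t) (\<phi> x) + cscale t (\<phi> y)"
    if xy: "x \<in> ?S" "y \<in> ?S" for x y t
  proof -
    obtain k l where k: "k \<in> ?C" "jet_vector m k = L x" "\<phi> x = jet m (k \<odot> h0)"
      and l: "l \<in> ?C" "jet_vector m l = L y" "\<phi> y = jet m (l \<odot> h0)"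
      using rep xy by blast
    let ?k = "cscale (1 - t) k + cscale t l"
    have S: "(\<lambda>i. (1 - t) * x i) \<in> ?S" "(\<lambda>i. t * y i) \<in> ?S"
      "(\<lambda>i. (1 - t) * x i + t * y i) \<in> ?S"
      using xy by (auto simp: Cspace_def)
    have "?k \<in> ?C" by (intro formal_centralizer_affine k l) simp
    moreover have "jet_vector m ?k = L (\<lambda>i. (1 - t) * x i + t * y i)"
      using add[OF S(1,2)] scale xy k l by (simp add: jet_vector_add jet_vector_cscale)
    ultimately have "\<phi> (\<lambda>i. (1 - t) * x i + t * y i) = jet m (?k \<odot> h0)"
      using \<phi> S(3) by blast
    also have "\<dots> = cscale (1 - t) (\<phi> x) + cscale t (\<phi> y)"
      by (simp add: k(3) l(3) add_fcomp cscale_fcomp jet_add jet_cscale)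
    finally show ?thesis .
  qed
  ultimately show ?thesis
    unfolding affine_iso_on_def bij_betw_def by blast
qed

section \<open>Truncated norms\<close>

text \<open>The \<open>d\<close>-th partial sum, by degree, of the weighted \<open>\<ell>\<^sup>1\<close> norm on the polydisc of radius \<open>r\<close>.\<close>

definition trunc_norm :: "nat \<Rightarrow> real \<Rightarrow> 'n::finite mfps \<Rightarrow> real" where
  "trunc_norm d r a = (\<Sum>\<alpha> | mdeg \<alpha> \<le> d. norm (mcoeff a \<alpha>) * r ^ mdeg \<alpha>)"

lemma trunc_norm_nonneg: "r \<ge> 0 \<Longrightarrow> 0 \<le> trunc_norm d r a"
  by (simp add: trunc_norm_def sum_nonneg)

lemma trunc_norm_diff:
  assumes "r \<ge> 0"
  shows "trunc_norm d r (a - b) \<le> trunc_norm d r a + trunc_norm d r b"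
proof -
  have "norm (mcoeff a \<alpha> - mcoeff b \<alpha>) * r ^ mdeg \<alpha>
      \<le> norm (mcoeff a \<alpha>) * r ^ mdeg \<alpha> + norm (mcoeff b \<alpha>) * r ^ mdeg \<alpha>" for \<alpha>
    using mult_right_mono[OF norm_triangle_ineq4[of "mcoeff a \<alpha>" "mcoeff b \<alpha>"], of "r ^ mdeg \<alpha>"]
      assms by (simp add: distrib_right)
  then show ?thesis
    unfolding trunc_norm_def by (simp add: sum.distrib[symmetric] sum_mono)
qed

lemma trunc_norm_cong:
  assumes "ord_ge (Suc d) (a - b)"
  shows "trunc_norm d r a = trunc_norm d r b"
  unfolding trunc_norm_def using assms by (intro sum.cong) (auto simp: ord_ge_def)

text \<open>Products of two terms of degree at most \<open>d\<close> cover all terms of the product of degree at most \<open>d\<close>, and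
more.\<close>

lemma trunc_norm_mult:
  assumes r: "r \<ge> 0"
  shows "trunc_norm d r (a * b) \<le> trunc_norm d r a * trunc_norm d r b"
proof -
  let ?D = "{\<alpha> :: nat ^ 'a. mdeg \<alpha> \<le> d}"
  let ?x = "\<lambda>a \<alpha>. norm (mcoeff a \<alpha>) * r ^ mdeg \<alpha>"
  have fin: "finite ?D" by (rule finite_mdeg_le)
  have "norm (mcoeff (a * b) \<gamma>) * r ^ mdeg \<gamma> \<le> (\<Sum>p\<in>splits \<gamma>. ?x a (fst p) * ?x b (snd p))" for \<gamma>
  proof -
    have "norm (mcoeff (a * b) \<gamma>) \<le> (\<Sum>p\<in>splits \<gamma>. norm (mcoeff a (fst p)) * norm (mcoeff b (snd p)))"
      unfolding mcoeff_mult split_def norm_mult[symmetric] by (rule norm_sum)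
    then have "norm (mcoeff (a * b) \<gamma>) * r ^ mdeg \<gamma>
        \<le> (\<Sum>p\<in>splits \<gamma>. norm (mcoeff a (fst p)) * norm (mcoeff b (snd p))) * r ^ mdeg \<gamma>"
      using r by (intro mult_right_mono) auto
    also have "\<dots> = (\<Sum>p\<in>splits \<gamma>. ?x a (fst p) * ?x b (snd p))"
      unfolding sum_distrib_right
      by (intro sum.cong) (auto simp: splits_def mdeg_add power_add)
    finally show ?thesis .
  qed
  then have "trunc_norm d r (a * b) \<le> (\<Sum>\<gamma>\<in>?D. \<Sum>p\<in>splits \<gamma>. ?x a (fst p) * ?x b (snd p))"
    unfolding trunc_norm_def by (intro sum_mono)
  also have "\<dots> = (\<Sum>(\<gamma>, p)\<in>Sigma ?D splits. ?x a (fst p) * ?x b (snd p))"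
    using fin by (subst sum.Sigma) auto
  also have "\<dots> = (\<Sum>p | fst p + snd p \<in> ?D. ?x a (fst p) * ?x b (snd p))"
    by (rule sum.reindex_bij_witness[of _ "\<lambda>p. (fst p + snd p, p)" snd]) (auto simp: splits_def)
  also have "\<dots> \<le> (\<Sum>p\<in>?D \<times> ?D. ?x a (fst p) * ?x b (snd p))"
    using fin r by (intro sum_mono2) (auto simp: mdeg_add)
  also have "\<dots> = trunc_norm d r a * trunc_norm d r b"
    unfolding trunc_norm_def sum_product sum.cartesian_product by (simp add: split_def)
  finally show ?thesis .
qed

lemma trunc_norm_one: "trunc_norm d r (1 :: 'n::finite mfps) = 1"
proof -
  have "trunc_norm d r (1 :: 'n mfps) = (\<Sum>\<alpha>\<in>{\<alpha> :: nat ^ 'n. mdeg \<alpha> \<le> d}. if \<alpha> = 0 then 1 else 0)"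
    unfolding trunc_norm_def by (intro sum.cong) (auto simp: mcoeff_one)
  then show ?thesis by (simp add: finite_mdeg_le)
qed

lemma trunc_norm_var:
  assumes "r \<ge> 0"
  shows "trunc_norm d r (mfps_var i) \<le> r"
proof -
  have "trunc_norm d r (mfps_var i) = (\<Sum>\<alpha> | mdeg \<alpha> \<le> d. if \<alpha> = axis i 1 then r else 0)"
    unfolding trunc_norm_def by (intro sum.cong) (auto simp: mfps_var_def)
  then show ?thesis using assms by (simp add: finite_mdeg_le)
qed

lemma trunc_norm_mpow:
  assumes r: "r \<ge> 0" and H: "\<And>j. trunc_norm d r (H $ j) \<le> R"
  shows "trunc_norm d r (mpow H \<alpha>) \<le> R ^ mdeg \<alpha>"
proof -
  have R: "R \<ge> 0" using H trunc_norm_nonneg[OF r] order_trans by blast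
  show ?thesis
  proof (rule graded_mpow[where R = "\<lambda>p a _. trunc_norm d r a \<le> R ^ p" and K = H])
    fix p q and a b a' b' :: "'a mfps"
    assume "trunc_norm d r a \<le> R ^ p" "trunc_norm d r b \<le> R ^ q"
    then have "trunc_norm d r a * trunc_norm d r b \<le> R ^ p * R ^ q"
      using R trunc_norm_nonneg[OF r] by (intro mult_mono) auto
    then show "trunc_norm d r (a * b) \<le> R ^ (p + q)"
      using trunc_norm_mult[OF r, of d a b] by (simp add: power_add)
  qed (use H in \<open>simp_all add: trunc_norm_one\<close>)
qed

text \<open>If \<open>H\<close> maps the polydisc of radius \<open>r\<close> into that of radius \<open>R\<close>, in the sense of norms, then
\<open>a \<circ> H\<close> is bounded by \<open>a\<close>. The same truncation appears on both sides, so that bounds can be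
proved by induction on \<open>d\<close>.\<close>

lemma trunc_norm_subst:
  assumes r: "r \<ge> 0" and nc: "no_const H" and H: "\<And>j. trunc_norm d r (H $ j) \<le> R"
  shows "trunc_norm d r (mfps_subst a H) \<le> trunc_norm d R a"
proof -
  let ?D = "{\<alpha> :: nat ^ 'a. mdeg \<alpha> \<le> d}"
  have "trunc_norm d r (mfps_subst a H) \<le>
      (\<Sum>\<gamma>\<in>?D. \<Sum>\<alpha>\<in>?D. norm (mcoeff a \<alpha>) * (norm (mcoeff (mpow H \<alpha>) \<gamma>) * r ^ mdeg \<gamma>))"
    unfolding trunc_norm_def
  proof (rule sum_mono)
    fix \<gamma> :: "nat ^ 'a"
    assume "\<gamma> \<in> ?D"
    then have "norm (mcoeff (mfps_subst a H) \<gamma>)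
        \<le> (\<Sum>\<alpha>\<in>?D. norm (mcoeff a \<alpha>) * norm (mcoeff (mpow H \<alpha>) \<gamma>))"
      by (simp add: mcoeff_subst_upto[OF nc, of \<gamma> d] norm_mult[symmetric] norm_sum)
    then have "norm (mcoeff (mfps_subst a H) \<gamma>) * r ^ mdeg \<gamma>
        \<le> (\<Sum>\<alpha>\<in>?D. norm (mcoeff a \<alpha>) * norm (mcoeff (mpow H \<alpha>) \<gamma>)) * r ^ mdeg \<gamma>"
      using r by (intro mult_right_mono) auto
    then show "norm (mcoeff (mfps_subst a H) \<gamma>) * r ^ mdeg \<gamma>
        \<le> (\<Sum>\<alpha>\<in>?D. norm (mcoeff a \<alpha>) * (norm (mcoeff (mpow H \<alpha>) \<gamma>) * r ^ mdeg \<gamma>))"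
      by (simp add: sum_distrib_right mult.assoc)
  qed
  also have "\<dots> = (\<Sum>\<alpha>\<in>?D. norm (mcoeff a \<alpha>) * trunc_norm d r (mpow H \<alpha>))"
    unfolding trunc_norm_def sum_distrib_left by (rule sum.swap)
  also have "\<dots> \<le> trunc_norm d R a"
    unfolding trunc_norm_def[of d R]
    by (intro sum_mono mult_left_mono trunc_norm_mpow r H) auto
  finally show ?thesis .
qed

lemma trunc_norm_jet:
  assumes "r \<ge> 0"
  shows "trunc_norm d r (jet m F $ i) \<le> trunc_norm m r (F $ i)"
proof -
  let ?t = "\<lambda>\<alpha>. norm (mcoeff (F $ i) \<alpha>) * r ^ mdeg \<alpha>"
  have "trunc_norm d r (jet m F $ i) = (\<Sum>\<alpha> | mdeg \<alpha> \<le> d \<and> mdeg \<alpha> \<le> m. ?t \<alpha>)"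
    unfolding trunc_norm_def
    by (rule sum.mono_neutral_cong_right) (auto simp: finite_mdeg_le mcoeff_jet)
  also have "\<dots> \<le> trunc_norm m r (F $ i)"
    unfolding trunc_norm_def using assms by (intro sum_mono2) (auto simp: finite_mdeg_le)
  finally show ?thesis .
qed

text \<open>Shrinking the radius makes a tuple without constant term, or a remainder of order 2, as small as
required.\<close>

lemma trunc_norm_scale:
  assumes "ord_ge p a" "0 \<le> s" "s \<le> 1" "0 \<le> r"
  shows "trunc_norm d (s * r) a \<le> s ^ p * trunc_norm d r a"
  unfolding trunc_norm_def sum_distrib_left
proof (rule sum_mono)
  fix \<alpha> :: "nat ^ 'a"
  show "norm (mcoeff a \<alpha>) * (s * r) ^ mdeg \<alpha> \<le> s ^ p * (norm (mcoeff a \<alpha>) * r ^ mdeg \<alpha>)"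
  proof (cases "mdeg \<alpha> < p")
    case True
    then show ?thesis using assms(1) by (simp add: ord_ge_def)
  next
    case False
    then have "s ^ mdeg \<alpha> \<le> s ^ p" using assms by (intro power_decreasing) auto
    then have "s ^ mdeg \<alpha> * (norm (mcoeff a \<alpha>) * r ^ mdeg \<alpha>)
        \<le> s ^ p * (norm (mcoeff a \<alpha>) * r ^ mdeg \<alpha>)"
      using assms by (intro mult_right_mono) auto
    then show ?thesis by (simp add: power_mult_distrib mult.left_commute)
  qed
qed

section \<open>Converging tuples\<close>

text \<open>Absolute convergence on the closed polydisc of radius \<open>r\<close>, with one bound for all components.\<close>

definition bounded_at :: "real \<Rightarrow> 'n::finite mfps ^ 'n \<Rightarrow> real \<Rightarrow> bool" where
  "bounded_at r F C \<longleftrightarrow> (\<forall>d i. trunc_norm d r (F $ i) \<le> C)"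

lemma summable_iff_trunc_norm_bounded:
  assumes r: "r \<ge> 0"
  shows "(\<lambda>\<alpha>. norm (mcoeff a \<alpha>) * r ^ mdeg \<alpha>) summable_on UNIV \<longleftrightarrow> (\<exists>C. \<forall>d. trunc_norm d r a \<le> C)"
    (is "?t summable_on UNIV \<longleftrightarrow> _")
proof
  assume "?t summable_on UNIV"
  then have "trunc_norm d r a \<le> infsum ?t UNIV" for d
    unfolding trunc_norm_def using r by (intro finite_sum_le_infsum) (auto simp: finite_mdeg_le)
  then show "\<exists>C. \<forall>d. trunc_norm d r a \<le> C" by blast
next
  assume "\<exists>C. \<forall>d. trunc_norm d r a \<le> C"
  then obtain C where C: "\<And>d. trunc_norm d r a \<le> C" by blast
  have "sum ?t S \<le> C" if "finite S" for S
  proof -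
    have "finite (mdeg ` S)" using that by simp
    then obtain d where "mdeg ` S \<subseteq> {..d}"
      using finite_nat_iff_bounded_le by blast
    then have "sum ?t S \<le> trunc_norm d r a"
      unfolding trunc_norm_def using r by (intro sum_mono2) (auto simp: finite_mdeg_le)
    with C[of d] show ?thesis by simp
  qed
  then show "?t summable_on UNIV"
    using r by (intro nonneg_bounded_partial_sums_imp_summable_on[of _ _ C])
      (auto intro!: eventually_finite_subsets_at_top_weakI)
qed

lemma converges_at_if_bounded:
  assumes bd: "bounded_at r F C" and z: "\<And>j. norm (z $ j) \<le> r"
  shows "converges_at F z"
  unfolding converges_at_def
proof
  fix i
  have r: "r \<ge> 0" using z norm_ge_zero order_trans by blast
  let ?t = "\<lambda>\<alpha>. norm (mcoeff (F $ i) \<alpha>) * r ^ mdeg \<alpha>"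
  let ?c = "\<lambda>\<alpha>. mcoeff (F $ i) \<alpha> * (\<Prod>j\<in>UNIV. (z $ j) ^ (\<alpha> $ j))"
  have "?t summable_on UNIV"
    using bd summable_iff_trunc_norm_bounded[OF r, of "F $ i"] by (auto simp: bounded_at_def)
  moreover have "norm (?c \<alpha>) \<le> ?t \<alpha>" for \<alpha>
  proof -
    have "(\<Prod>j\<in>UNIV. norm (z $ j) ^ (\<alpha> $ j)) \<le> (\<Prod>j\<in>UNIV. r ^ (\<alpha> $ j))"
      using z by (intro prod_mono) (auto intro: power_mono)
    then show ?thesis
      by (simp add: norm_mult prod_norm[symmetric] norm_power mdeg_def power_sum mult_left_mono)
  qed
  ultimately have "(\<lambda>\<alpha>. norm (?c \<alpha>)) summable_on UNIV"
    by (rule summable_on_comparison_test) auto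
  then show "?c summable_on UNIV" by (rule abs_summable_summable)
qed

lemma radius_ge_if_bounded: "bounded_at r F C \<Longrightarrow> radius_of_convergence_ge F r"
  unfolding radius_of_convergence_ge_def
  by (auto intro: converges_at_if_bounded less_imp_le)

lemma converging_if_bounded:
  assumes "bounded_at r F C" "r > 0"
  shows "converging F"
  unfolding converging_def eventually_nhds_metric
proof (intro exI conjI allI impI)
  fix z :: "complex ^ 'a"
  assume "dist z 0 < r"
  then have "norm (z $ j) \<le> r" for j
    using Finite_Cartesian_Product.norm_nth_le[of z j] by simp
  with assms(1) show "converges_at F z" by (rule converges_at_if_bounded)
qed (use assms in auto)

text \<open>Convergence at the single point \<open>(r, \<dots>, r)\<close> suffices: unconditional summability of complex numbers
is absolute summability.\<close>

lemma converging_bounded: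
  fixes F :: "'n::finite mfps ^ 'n"
  assumes "converging F"
  obtains r C where "r > 0" "C > 0" "bounded_at r F C"
proof -
  obtain e where e: "e > 0" and conv: "\<And>z. dist z 0 < e \<Longrightarrow> converges_at F z"
    using assms unfolding converging_def eventually_nhds_metric by blast
  (* The point (r, ..., r) has norm at most n r < e. *)
  define r where "r = e / (2 * CARD('n))"
  have r: "r > 0" using e by (simp add: r_def)
  let ?z = "(\<chi> j. complex_of_real r) :: complex ^ 'n"
  have "norm ?z \<le> (\<Sum>j\<in>(UNIV :: 'n set). norm (?z $ j))"
    unfolding norm_vec_def by (rule L2_set_le_sum) auto
  also have "\<dots> = CARD('n) * r" using r by simp
  also have "\<dots> < e" using e by (simp add: r_def)
  finally have conv_z: "converges_at F ?z" by (intro conv) simp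
  have "\<exists>C. \<forall>d. trunc_norm d r (F $ i) \<le> C" for i
  proof -
    have "(\<lambda>\<alpha>. mcoeff (F $ i) \<alpha> * complex_of_real r ^ mdeg \<alpha>) summable_on UNIV"
      using conv_z by (simp add: converges_at_def mdeg_def power_sum)
    then have "(\<lambda>\<alpha>. norm (mcoeff (F $ i) \<alpha> * complex_of_real r ^ mdeg \<alpha>)) summable_on UNIV"
      by (rule summable_on_iff_abs_summable_on_complex[THEN iffD1])
    then show ?thesis
      using r summable_iff_trunc_norm_bounded[of r "F $ i"] by (simp add: norm_mult norm_power)
  qed
  then obtain C where C: "\<And>i d. trunc_norm d r (F $ i) \<le> C i" by metis
  have "trunc_norm d r (F $ i) \<le> 1 + (\<Sum>i\<in>UNIV. \<bar>C i\<bar>)" for d i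
    using C[of d i] member_le_sum[of i UNIV "\<lambda>i. \<bar>C i\<bar>"] by simp
  then have "bounded_at r F (1 + (\<Sum>i\<in>UNIV. \<bar>C i\<bar>))" by (simp add: bounded_at_def)
  moreover have "1 + (\<Sum>i\<in>UNIV. \<bar>C i\<bar>) > 0" by (simp add: add_pos_nonneg sum_nonneg)
  ultimately show thesis using that r by blast
qed

lemma converging_fcomp:
  assumes "converging F" "converging H" "no_const H"
  shows "converging (F \<odot> H)"
proof -
  obtain R B where R: "R > 0" "bounded_at R F B"
    using converging_bounded[OF assms(1)] by blast
  obtain r C where r: "r > 0" and C: "C > 0" "bounded_at r H C"
    using converging_bounded[OF assms(2)] by blast
  define s where "s = min 1 (R / C)"
  have s: "s > 0" "s \<le> 1" "s * C \<le> R"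
    using R C by (auto simp: s_def min_def field_simps)
  have "trunc_norm d (s * r) (H $ j) \<le> R" for d j
  proof -
    have "trunc_norm d (s * r) (H $ j) \<le> s ^ 1 * trunc_norm d r (H $ j)"
      using assms(3) s r by (intro trunc_norm_scale) auto
    also have "\<dots> \<le> s * C" using C(2) s by (simp add: bounded_at_def)
    finally show ?thesis using s(3) by simp
  qed
  then have "trunc_norm d (s * r) ((F \<odot> H) $ i) \<le> B" for d i
    using trunc_norm_subst[of "s * r" H d R "F $ i"] R(2) s(1) r assms(3)
    by (fastforce simp: bounded_at_def intro: order_trans)
  then have "bounded_at (s * r) (F \<odot> H) B" by (simp add: bounded_at_def)
  then show ?thesis using s r by (intro converging_if_bounded[of "s * r" _ B]) auto
qed

text \<open>A polynomial is bounded on every polydisc, so no shrinking of the radius is needed here. This is the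
source of the uniform radius.\<close>

lemma bounded_at_jet_fcomp:
  assumes "bounded_at r H C" "no_const H" "r \<ge> 0" "C \<ge> 0"
  shows "\<exists>B. bounded_at r (jet m F \<odot> H) B"
proof -
  have "trunc_norm d r ((jet m F \<odot> H) $ i) \<le> (\<Sum>i\<in>UNIV. trunc_norm m C (F $ i))" for d i
  proof -
    have "trunc_norm d r ((jet m F \<odot> H) $ i) \<le> trunc_norm d C (jet m F $ i)"
      using assms by (auto simp: bounded_at_def intro!: trunc_norm_subst)
    also have "\<dots> \<le> trunc_norm m C (F $ i)" by (rule trunc_norm_jet[OF assms(4)])
    also have "\<dots> \<le> (\<Sum>i\<in>UNIV. trunc_norm m C (F $ i))"
      using trunc_norm_nonneg[OF assms(4)] by (intro member_le_sum) auto
    finally show ?thesis .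
  qed
  then show ?thesis unfolding bounded_at_def by blast
qed

text \<open>The inverse satisfies \<open>g = id - u \<odot> g\<close> with \<open>u\<close> of order 2. For a small radius \<open>R\<close> the norm of \<open>u\<close> is at most
\<open>R/2\<close>, as it is quadratic in \<open>R\<close>. Then \<open>\<parallel>g\<parallel> \<le> R\<close> on the polydisc of radius \<open>R/2\<close>: the truncation of
\<open>u \<odot> g\<close> at degree \<open>d + 1\<close> depends only on that of \<open>g\<close> at degree \<open>d\<close>, so the bound for \<open>d\<close> implies
\<open>R/2 + R/2\<close> for \<open>d + 1\<close>.\<close>

lemma converging_inverse:
  assumes h: "h \<in> Ghat0" and conv: "converging h"
  shows "converging (inv\<^bsub>Ghat\<^esub> h)"
proof -
  let ?g = "inv\<^bsub>Ghat\<^esub> h" and ?u = "h - linear_map (mat 1)"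
  have g: "no_const ?g" by (rule Ghat0_no_const[OF Ghat0_inverse(1)[OF h]])
  have "?u \<odot> ?g = linear_map (mat 1) - ?g"
    using g by (simp add: fcomp_diff linear_map_id_fcomp Ghat0_inverse(2)[OF h])
  then have fixpoint: "?g $ i = mfps_var i - mfps_subst (?u $ i) ?g" for i
    by (simp add: Finite_Cartesian_Product.vec_eq_iff)
  have u: "ord_ge 2 (?u $ i)" for i using h by (simp add: Ghat0_iff)
  obtain R1 C1 where R1: "R1 > 0" "C1 > 0" "bounded_at R1 h C1"
    using converging_bounded[OF conv] by blast
  define C where "C = C1 + R1"
  have C: "C > 0" "trunc_norm d R1 (?u $ i) \<le> C" for d i
  proof -
    show "C > 0" using R1 by (simp add: C_def)
    have "trunc_norm d R1 (h $ i) \<le> C1" using R1(3) by (simp add: bounded_at_def)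
    then show "trunc_norm d R1 (?u $ i) \<le> C"
      using R1(1) trunc_norm_diff[of R1 d "h $ i" "mfps_var i"] trunc_norm_var[of R1 d i]
      by (simp add: C_def)
  qed
  (* The quadratic bound s^2 C is at most s R1 / 2 = R / 2. *)
  define s where "s = min 1 (R1 / (2 * C))"
  have s: "s > 0" "s \<le> 1" "s * C \<le> R1 / 2"
    using R1 C by (auto simp: s_def min_def field_simps)
  define R where "R = s * R1"
  have R: "R > 0" using s R1 by (simp add: R_def)
  have small: "trunc_norm d R (?u $ i) \<le> R / 2" for d i
  proof -
    have "trunc_norm d R (?u $ i) \<le> s ^ 2 * trunc_norm d R1 (?u $ i)"
      unfolding R_def using u s R1 by (intro trunc_norm_scale) auto
    also have "\<dots> \<le> s ^ 2 * C" using C(2) by (intro mult_left_mono) auto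
    also have "\<dots> = s * (s * C)" by (simp add: power2_eq_square)
    also have "\<dots> \<le> s * (R1 / 2)" using s by (intro mult_left_mono) auto
    finally show ?thesis by (simp add: R_def)
  qed
  have "trunc_norm d (R / 2) (?g $ i) \<le> R" for d i
  proof (induction d arbitrary: i)
    case 0
    have "trunc_norm 0 (R / 2) (?g $ i) = 0"
      using g[unfolded ord_ge_1_iff] by (simp add: trunc_norm_def)
    then show ?case using R by simp
  next
    case (Suc d)
    let ?j = "jet d ?g"
    have j: "no_const ?j" using g by (simp add: ord_ge_def mcoeff_jet)
    have "ord_ge (d + 2) (mfps_subst (?u $ i) ?g - mfps_subst (?u $ i) ?j)"
      by (rule subst_close[OF g j _ u]) (simp add: ord_ge_def mcoeff_jet)
    then have "trunc_norm (Suc d) (R / 2) (mfps_subst (?u $ i) ?g)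
        = trunc_norm (Suc d) (R / 2) (mfps_subst (?u $ i) ?j)"
      by (intro trunc_norm_cong) (simp add: numeral_2_eq_2)
    also have "\<dots> \<le> trunc_norm (Suc d) R (?u $ i)"
    proof (rule trunc_norm_subst[OF _ j])
      show "trunc_norm (Suc d) (R / 2) (?j $ l) \<le> R" for l
        using trunc_norm_jet[of "R / 2" "Suc d" d ?g l] Suc.IH[of l] R by simp
    qed (use R in simp)
    also have "\<dots> \<le> R / 2" by (rule small)
    finally have "trunc_norm (Suc d) (R / 2) (mfps_var i - mfps_subst (?u $ i) ?g) \<le> R / 2 + R / 2"
      using R trunc_norm_diff[of "R / 2" "Suc d" "mfps_var i" "mfps_subst (?u $ i) ?g"]
        trunc_norm_var[of "R / 2" "Suc d" i] by simp
    then show ?case unfolding fixpoint[of i, symmetric] by simp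
  qed
  then have "bounded_at (R / 2) ?g R" by (simp add: bounded_at_def)
  then show ?thesis using R by (intro converging_if_bounded[of "R / 2" _ R]) auto
qed

section \<open>Converging linearizations\<close>

lemma holomorphic_centralizer_bij:
  assumes f: "f \<in> carrier Ghat" and h0: "h0 \<in> converging_linearizations f"
  shows "bij_betw (\<lambda>k. k \<odot> h0) (holomorphic_centralizer (linear_part f)) (converging_linearizations f)"
proof (rule bij_betw_byWitness[where f' = "\<lambda>h. h \<odot> inv\<^bsub>Ghat\<^esub> h0"])
  have lin: "h0 \<in> formal_linearizations f" and conv: "converging h0"
    using h0 by (auto simp: converging_linearizations_def)
  have G: "h0 \<in> Ghat0" using lin by (simp add: formal_linearizations_iff[OF f])
  note inv = Ghat0_inverse(1)[OF G]
  show "\<forall>k\<in>holomorphic_centralizer (linear_part f). k \<odot> h0 \<odot> inv\<^bsub>Ghat\<^esub> h0 = k"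
    using Ghat0_fcomp_inverse_cancel(2)[OF G Ghat0_no_const]
    by (auto simp: holomorphic_centralizer_def formal_centralizer_iff)
  show "\<forall>h\<in>converging_linearizations f. h \<odot> inv\<^bsub>Ghat\<^esub> h0 \<odot> h0 = h"
    using Ghat0_fcomp_inverse_cancel(1)[OF G Ghat0_no_const]
    by (auto simp: converging_linearizations_def formal_linearizations_iff[OF f])
  show "(\<lambda>k. k \<odot> h0) ` holomorphic_centralizer (linear_part f) \<subseteq> converging_linearizations f"
    using centralizer_fcomp_linearization[OF f lin] converging_fcomp[OF _ conv Ghat0_no_const[OF G]]
    by (auto simp: converging_linearizations_def holomorphic_centralizer_def)
  show "(\<lambda>h. h \<odot> inv\<^bsub>Ghat\<^esub> h0) ` converging_linearizations f
      \<subseteq> holomorphic_centralizer (linear_part f)"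
    using linearization_quotient_centralizer[OF f _ lin]
      converging_fcomp[OF _ converging_inverse[OF G conv] Ghat0_no_const[OF inv]]
    by (auto simp: converging_linearizations_def holomorphic_centralizer_def)
qed

text \<open>Write \<open>h = k \<odot> h0\<close> and replace \<open>k\<close> by the polynomial \<open>jet m k\<close>.\<close>

lemma jets_linearized_with_uniform_radius:
  assumes f: "f \<in> carrier Ghat" and h0: "h0 \<in> converging_linearizations f"
  shows "\<exists>R>0. \<forall>m\<ge>1. \<forall>h\<in>formal_linearizations f.
    \<exists>h'\<in>converging_linearizations f. jet m h' = jet m h \<and> radius_of_convergence_ge h' R"
proof -
  have lin: "h0 \<in> formal_linearizations f" and conv: "converging h0"
    using h0 by (auto simp: converging_linearizations_def)
  have G: "h0 \<in> Ghat0" using lin by (simp add: formal_linearizations_iff[OF f])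
  note nc = Ghat0_no_const[OF G]
  obtain R C where R: "R > 0" "C > 0" "bounded_at R h0 C"
    using converging_bounded[OF conv] by blast
  have "\<exists>h'\<in>converging_linearizations f. jet m h' = jet m h \<and> radius_of_convergence_ge h' R"
    if m: "m \<ge> 1" and h: "h \<in> formal_linearizations f" for m h
  proof -
    let ?k = "h \<odot> inv\<^bsub>Ghat\<^esub> h0"
    let ?h = "jet m ?k \<odot> h0"
    have "?k \<in> formal_centralizer (linear_part f)"
      by (rule linearization_quotient_centralizer[OF f h lin])
    then have "?h \<in> formal_linearizations f"
      by (intro centralizer_fcomp_linearization[OF f lin] jet_formal_centralizer[OF m])
    moreover obtain B where B: "bounded_at R ?h B"
      using bounded_at_jet_fcomp[OF R(3) nc] R(1,2) by (meson less_imp_le)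
    moreover have "jet m ?h = jet m (?k \<odot> h0)"
      by (rule jet_fcomp_cong[OF nc jet_jet])
    moreover have "?k \<odot> h0 = h"
      using h Ghat0_no_const[of h]
      by (intro Ghat0_fcomp_inverse_cancel(1)[OF G]) (simp add: formal_linearizations_iff[OF f])
    ultimately show ?thesis
      using converging_if_bounded[OF B R(1)] radius_ge_if_bounded[OF B]
      by (auto simp: converging_linearizations_def)
  qed
  then show ?thesis using R(1) by blast
qed

theorem theorem3:
  fixes f :: "'n::{finite, linorder} mfps ^ ('n::{finite, linorder})"
    and A :: "complex ^ ('n::{finite, linorder}) ^ ('n::{finite, linorder})"
  assumes "f \<in> carrier Ghat" and "converging f"
    and "A = linear_part f" and "in_jordan_normal_form A"
  shows "let
      total_convergence =
        (formal_linearizations f \<noteq> {} \<and>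
         (\<forall>m\<ge>2. jet m ` formal_linearizations f = jet m ` converging_linearizations f \<and>
            (\<forall>h0\<in>formal_linearizations f.
               (\<exists>\<phi>. jet_identification A h0 m \<phi>) \<and>
               (\<forall>\<phi>. jet_identification A h0 m \<phi> \<longrightarrow>
                  affine_iso_on (Cspace (centralizer_dim A m))
                    (jet m ` formal_linearizations f) \<phi>))) \<and>
         (\<forall>h0\<in>converging_linearizations f.
            bij_betw (\<lambda>k. k \<otimes>\<^bsub>Ghat\<^esub> h0)
              (holomorphic_centralizer A) (converging_linearizations f)) \<and>
         (\<exists>R0>0. \<forall>m\<ge>2. \<forall>h0\<in>formal_linearizations f. \<forall>\<phi>. jet_identification A h0 m \<phi> \<longrightarrow>
            (\<forall>s\<in>Cspace (centralizer_dim A m). \<exists>h\<in>formal_linearizations f.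
               jet m h = \<phi> s \<and> radius_of_convergence_ge h R0)));
      general_divergence = (\<forall>h\<in>formal_linearizations f. \<not> converging h)
    in (total_convergence \<or> general_divergence) \<and> \<not> (total_convergence \<and> general_divergence)"
proof -
  note f = assms(1)
  let ?lin = "formal_linearizations f" and ?conv = "converging_linearizations f"
  let ?iso = "\<lambda>m \<phi>. affine_iso_on (Cspace (centralizer_dim A m)) (jet m ` ?lin) \<phi>"
  have iso: "(\<exists>\<phi>. jet_identification A h0 m \<phi>) \<and> (\<forall>\<phi>. jet_identification A h0 m \<phi> \<longrightarrow> ?iso m \<phi>)"
    if "h0 \<in> ?lin" for h0 m
    using that jet_identification_exists[of h0 A m] jet_identification_affine_iso[OF f that]
    by (auto simp: assms(3) formal_linearizations_iff[OF f])
  have jets: "jet m ` ?lin = jet m ` ?conv" if "m \<ge> 2" "?conv \<noteq> {}" for m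
  proof
    show "jet m ` ?lin \<subseteq> jet m ` ?conv"
    proof clarify
      fix h
      assume "h \<in> ?lin"
      with jets_linearized_with_uniform_radius[OF f] that obtain h' where "h' \<in> ?conv" "jet m h' = jet m h"
        by (metis all_not_in_conv one_le_numeral order_trans)
      then show "jet m h \<in> jet m ` ?conv" by (metis imageI)
    qed
  qed (auto simp: converging_linearizations_def)
  have radius: "\<exists>R0>0. \<forall>m\<ge>2. \<forall>h0\<in>?lin. \<forall>\<phi>. jet_identification A h0 m \<phi> \<longrightarrow>
      (\<forall>s\<in>Cspace (centralizer_dim A m). \<exists>h\<in>?lin. jet m h = \<phi> s \<and> radius_of_convergence_ge h R0)"
    if nonempty: "?conv \<noteq> {}"
  proof -
    obtain R where R: "R > 0" and approx: "\<And>m h. m \<ge> 1 \<Longrightarrow> h \<in> ?lin \<Longrightarrow>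
        \<exists>h'\<in>?conv. jet m h' = jet m h \<and> radius_of_convergence_ge h' R"
      using nonempty jets_linearized_with_uniform_radius[OF f] by blast
    have "\<exists>h\<in>?lin. jet m h = \<phi> s \<and> radius_of_convergence_ge h R"
      if "m \<ge> 2" "h0 \<in> ?lin" "jet_identification A h0 m \<phi>" "s \<in> Cspace (centralizer_dim A m)"
      for m h0 \<phi> s
    proof -
      have "\<phi> s \<in> jet m ` ?lin"
        using iso[OF that(2), of m] that(3,4) unfolding affine_iso_on_def bij_betw_def by blast
      then obtain h where "h \<in> ?lin" "\<phi> s = jet m h" by blast
      then show ?thesis
        using approx[of m h] that(1) by (auto simp: converging_linearizations_def)
    qed
    with R show ?thesis by blast
  qed
  have bij: "bij_betw (\<lambda>k. k \<otimes>\<^bsub>Ghat\<^esub> h0) (holomorphic_centralizer A) ?conv"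
    if "h0 \<in> ?conv" for h0
    using holomorphic_centralizer_bij[OF f that] by (simp add: assms(3))
  show ?thesis
  proof (cases "?conv = {}")
    case True
    show ?thesis
      unfolding Let_def
    proof (intro conjI disjI2 notI, goal_cases)
      case 1
      show ?case using True by (auto simp: converging_linearizations_def)
    next
      case 2
      then have "?lin \<noteq> {}" and "\<forall>m\<ge>2. jet m ` ?lin = jet m ` ?conv" by blast+
      then have "jet 2 ` ?lin = jet 2 ` ?conv" by blast
      with True \<open>?lin \<noteq> {}\<close> show ?case by simp
    qed
  next
    case False
    show ?thesis
      unfolding Let_def
    proof (intro conjI disjI1, goal_cases)
      case 1
      show ?case using False by (auto simp: converging_linearizations_def)
    next
      case 2
      show ?case using iso jets[OF _ False] by blast
    next
      case 3
      show ?case using bij by blast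
    next
      case 4
      show ?case by (rule radius[OF False])
    next
      case 5
      show ?case using False by (auto simp: converging_linearizations_def)
    qed
  qed
qed

end
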